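(* Let $\mathbb{K}$ be a field. For every finite poset $\mathcal{P}$ there exists a synor complex $(\mathcal{S}_*(\mathcal{P}),\delta_* )$ for $\mathcal{P}$.
   Context: Chains. For a finite poset $\mathcal{P}$ and $k \ge -1$, $\widetilde{C}_k(\mathcal{P})$ is the $\mathbb{K}$-vector space with basis the order chains $(x_0 > \cdots > x_k)$ in $\mathcal{P}$ (for $k=-1$ the empty chain, so $\widetilde{C}_{-1}=\mathbb{K}$), with $\partial_k = \sum_{j=0}^k (-1)^j\partial_k^{(j)}$, where $\partial_k^{(j)}$ deletes $x_j$. Its homology is $\widetilde{H}_*(\mathcal{P})$. $\mathcal{P}_{<x}=\{y\in \mathcal{P}: y<x\}$; an order ideal is a subset closed under passing to smaller elements. Graded complexes. A $\mathcal{P}$-graded complex is a complex $(C_*,\partial_* )$ of $\mathbb{K}$-vector spaces (in degrees $\ge -1$) with $C_{-1}=\mathbb{K}$, $C_i = \bigoplus_{x\in\mathcal{P}} C_i^{(x)}$ for $i\ge 0$, and $\partial_i(C_i^{(x)}) \subseteq \bigoplus_{y \le x} C_{i-1}^{(y)}$ for $i\ge1$; it is strictly $\mathcal{P}$-graded if $\partial_i(C_i^{(x)}) \subseteq \bigoplus_{y<x} C_{i-1}^{(y)}$ for $i\ge 1$. $\widetilde{C}_*(\mathcal{P})$ is $\mathcal{P}$-graded, with $\widetilde{C}_i(\mathcal{P})^{(x)}$ spanned by the chains with largest element $x$. For an order ideal $\mathcal{J}$, $C_*^{\mathcal{J}}$ is the subcomplex with $C_i^{\mathcal{J}}=\bigoplus_{x\in\mathcal{J}}C_i^{(x)}$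 for $i \ge 0$ and $C_{-1}^{\mathcal{J}}=\mathbb{K}$. A $\mathcal{P}$-graded chain map $\phi: C_*\to D_*$ is a chain map with $\phi(C_i^{(x)})\subseteq D_i^{(x)}$ for all $x \in \mathcal{P}$, $i\ge 0$ and $\phi(C_{-1})=D_{-1}$. Synor complex. A synor complex for $\mathcal{P}$ is a strictly $\mathcal{P}$-graded complex $(\mathcal{S}_*(\mathcal{P}),\delta_* )$ together with an injective $\mathcal{P}$-graded chain map $\phi:\mathcal{S}_*(\mathcal{P})\to\widetilde{C}_*(\mathcal{P})$ such that (S1) $\dim_{\mathbb{K}}\mathcal{S}_i(\mathcal{P})^{(x)}=\dim_{\mathbb{K}}\widetilde{H}_{i-1}(\mathcal{P}_{<x})$ for every $x \in \mathcal{P}$ and $i\ge0$; (S2) for every order ideal $\mathcal{J}$ of $\mathcal{P}$ the restriction of $\phi$ to $\mathcal{S}_*(\mathcal{P})^{\mathcal{J}}$ induces an isomorphism between $H_*(\mathcal{S}(\mathcal{P})^{\mathcal{J}})$ and $\widetilde{H}_*(\mathcal{J})$. *)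

theory Defs
  imports
    "HOL-Library.Poly_Mapping"
    "HOL-Algebra.AbelCoset"
    "Jordan_Normal_Form.VS_Connect"
begin

section \<open>Direct sums and quotients of vector spaces\<close>

text \<open>The index set \<open>Q\<close> of a sum is always finite, so that \<open>finsum\<close> is meaningful.\<close>

definition sum_of_subspaces :: "('k, 'v) module \<Rightarrow> ('a \<Rightarrow> 'v set) \<Rightarrow> 'a set \<Rightarrow> 'v set" where
  "sum_of_subspaces V W Q = (\<lambda>w. finsum V w Q) ` (\<Pi> x\<in>Q. W x)"

definition internal_direct_sum :: "('k::field, 'v) module \<Rightarrow> ('a \<Rightarrow> 'v set) \<Rightarrow> 'a set \<Rightarrow> bool" where
  "internal_direct_sum V W Q \<longleftrightarrow>
     (\<forall>x\<in>Q. subspace class_ring (W x) V) \<and>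
     bij_betw (\<lambda>w. finsum V w Q) (\<Pi>\<^sub>E x\<in>Q. W x) (carrier V)"

text \<open>The fields \<open>mult\<close> and \<open>one\<close>, which records for modules inherit from records for rings,
  have no meaning for vector spaces; they are given dummy values below.\<close>

definition quotient_space :: "('k, 'v) module \<Rightarrow> 'v set \<Rightarrow> ('k, 'v set) module" where
  "quotient_space V W =
     \<lparr>carrier = a_rcosets\<^bsub>V\<^esub> W,
      mult = (\<lambda>_ _. W),
      one = W,
      zero = W,
      add = (\<lambda>X Y. X <+>\<^bsub>V\<^esub> Y),
      smult = (\<lambda>a X. \<Union>v\<in>X. W +>\<^bsub>V\<^esub> (a \<odot>\<^bsub>V\<^esub> v))\<rparr>"

definition free_space :: "'b set \<Rightarrow> ('k::field, 'b \<Rightarrow>\<^sub>0 'k) module" where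
  "free_space X =
     \<lparr>carrier = {c. Poly_Mapping.keys c \<subseteq> X},
      mult = (\<lambda>_ _. 0),
      one = 0,
      zero = 0,
      add = (+),
      smult = (\<lambda>a. Poly_Mapping.map ((*) a))\<rparr>"

section \<open>Graded complexes\<close>

text \<open>Complexes are indexed by all integers. A complex in degrees \<open>\<ge> -1\<close> is one that vanishes in the
  degrees \<open>< -1\<close>; in particular every element of degree \<open>-1\<close> is a cycle.\<close>

record ('k, 'v, 'a) graded_complex =
  component :: "int \<Rightarrow> ('k, 'v) module"
  differential :: "int \<Rightarrow> 'v \<Rightarrow> 'v"
  summand :: "int \<Rightarrow> 'a \<Rightarrow> 'v set"

definition is_complex :: "('k::field, 'v, 'a) graded_complex \<Rightarrow> bool" where
  "is_complex C \<longleftrightarrow>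
     (\<forall>i. linear_map class_ring (component C i) (component C (i - 1)) (differential C i)) \<and>
     (\<forall>i. \<forall>c\<in>carrier (component C i).
        differential C (i - 1) (differential C i c) = \<zero>\<^bsub>component C (i - 2)\<^esub>) \<and>
     (\<forall>i. i < -1 \<longrightarrow> carrier (component C i) = {\<zero>\<^bsub>component C i\<^esub>})"

text \<open>The poset is the set \<open>P\<close> ordered by \<open>r\<close>, with \<open>(y, x) \<in> r\<close> meaning \<open>y \<le> x\<close>. The equality
  \<open>C\<^sub>-\<^sub>1 = K\<close> is read as a linear isomorphism \<open>K \<cong> C\<^sub>-\<^sub>1\<close>, which necessarily has the form
  \<open>a \<mapsto> a e\<close>.\<close>

definition is_graded :: "'a rel \<Rightarrow> 'a set \<Rightarrow> ('k::field, 'v, 'a) graded_complex \<Rightarrow> bool" where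
  "is_graded r P C \<longleftrightarrow>
     is_complex C \<and>
     (\<exists>e\<in>carrier (component C (-1)).
        bij_betw (\<lambda>a. a \<odot>\<^bsub>component C (-1)\<^esub> e) UNIV (carrier (component C (-1)))) \<and>
     (\<forall>i\<ge>0. internal_direct_sum (component C i) (summand C i) P) \<and>
     (\<forall>i\<ge>1. \<forall>x\<in>P. differential C i ` summand C i x \<subseteq>
        sum_of_subspaces (component C (i - 1)) (summand C (i - 1)) {y\<in>P. (y, x) \<in> r})"

definition below :: "'a rel \<Rightarrow> 'a set \<Rightarrow> 'a \<Rightarrow> 'a set" where
  "below r P x = {y\<in>P. (y, x) \<in> r \<and> y \<noteq> x}"

definition is_strictly_graded :: "'a rel \<Rightarrow> 'a set \<Rightarrow> ('k::field, 'v, 'a) graded_complex \<Rightarrow> bool" where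
  "is_strictly_graded r P C \<longleftrightarrow>
     is_graded r P C \<and>
     (\<forall>i\<ge>1. \<forall>x\<in>P. differential C i ` summand C i x \<subseteq>
        sum_of_subspaces (component C (i - 1)) (summand C (i - 1)) (below r P x))"

definition order_ideal :: "'a rel \<Rightarrow> 'a set \<Rightarrow> 'a set \<Rightarrow> bool" where
  "order_ideal r P J \<longleftrightarrow> J \<subseteq> P \<and> (\<forall>x\<in>J. \<forall>y\<in>P. (y, x) \<in> r \<longrightarrow> y \<in> J)"

definition restrict_complex ::
  "'a set \<Rightarrow> ('k, 'v, 'a) graded_complex \<Rightarrow> ('k, 'v, 'a) graded_complex" where
  "restrict_complex J C = C\<lparr>component := (\<lambda>i.
     if i \<ge> 0 then (component C i)\<lparr>carrier := sum_of_subspaces (component C i) (summand C i) J\<rparr>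
     else component C i)\<rparr>"

definition graded_chain_map ::
  "'a set \<Rightarrow> ('k::field, 'v, 'a) graded_complex \<Rightarrow> ('k, 'w, 'a) graded_complex \<Rightarrow>
   (int \<Rightarrow> 'v \<Rightarrow> 'w) \<Rightarrow> bool" where
  "graded_chain_map P C D f \<longleftrightarrow>
     (\<forall>i. linear_map class_ring (component C i) (component D i) (f i)) \<and>
     (\<forall>i. \<forall>c\<in>carrier (component C i). f (i - 1) (differential C i c) = differential D i (f i c)) \<and>
     (\<forall>i\<ge>0. \<forall>x\<in>P. f i ` summand C i x \<subseteq> summand D i x) \<and>
     f (-1) ` carrier (component C (-1)) = carrier (component D (-1))"

section \<open>Homology\<close>

definition cycles :: "('k, 'v, 'a) graded_complex \<Rightarrow> int \<Rightarrow> 'v set" where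
  "cycles C i = {c \<in> carrier (component C i). differential C i c = \<zero>\<^bsub>component C (i - 1)\<^esub>}"

definition boundaries :: "('k, 'v, 'a) graded_complex \<Rightarrow> int \<Rightarrow> 'v set" where
  "boundaries C i = differential C (i + 1) ` carrier (component C (i + 1))"

definition homology :: "('k, 'v, 'a) graded_complex \<Rightarrow> int \<Rightarrow> ('k, 'v set) module" where
  "homology C i = quotient_space ((component C i)\<lparr>carrier := cycles C i\<rparr>) (boundaries C i)"

text \<open>The homology class of \<open>c\<close> is sent to that of \<open>f i c\<close>; all representatives \<open>c\<close> of a class
  \<open>X\<close> contribute the same coset to the union.\<close>

definition induced_map ::
  "('k, 'w, 'a) graded_complex \<Rightarrow> (int \<Rightarrow> 'v \<Rightarrow> 'w) \<Rightarrow> int \<Rightarrow> 'v set \<Rightarrow> 'w set" where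
  "induced_map D f i X = (\<Union>c\<in>X. boundaries D i +>\<^bsub>component D i\<^esub> f i c)"

definition induces_homology_iso ::
  "('k::field, 'v, 'a) graded_complex \<Rightarrow> ('k, 'w, 'a) graded_complex \<Rightarrow>
   (int \<Rightarrow> 'v \<Rightarrow> 'w) \<Rightarrow> bool" where
  "induces_homology_iso C D f \<longleftrightarrow>
     (\<forall>i. linear_map class_ring (homology C i) (homology D i) (induced_map D f i) \<and>
          bij_betw (induced_map D f i) (carrier (homology C i)) (carrier (homology D i)))"

section \<open>The chain complex of a poset\<close>

text \<open>A chain \<open>x\<^sub>0 > \<dots> > x\<^sub>k\<close> is the list \<open>[x\<^sub>0, \<dots>, x\<^sub>k]\<close>; its largest element is the head.\<close>

definition order_chains :: "'a rel \<Rightarrow> 'a set \<Rightarrow> int \<Rightarrow> 'a list set" where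
  "order_chains r P k =
     {xs. int (length xs) = k + 1 \<and> set xs \<subseteq> P \<and> sorted_wrt (\<lambda>x y. (y, x) \<in> r \<and> y \<noteq> x) xs}"

definition boundary :: "('a list \<Rightarrow>\<^sub>0 'k) \<Rightarrow> ('a list \<Rightarrow>\<^sub>0 'k::field)" where
  "boundary c = (\<Sum>xs\<in>Poly_Mapping.keys c. \<Sum>j<length xs.
     Poly_Mapping.single (take j xs @ drop (Suc j) xs) ((-1) ^ j * Poly_Mapping.lookup c xs))"

definition order_complex :: "'a rel \<Rightarrow> 'a set \<Rightarrow> ('k::field, 'a list \<Rightarrow>\<^sub>0 'k, 'a) graded_complex" where
  "order_complex r P =
     \<lparr>component = (\<lambda>k. free_space (order_chains r P k)),
      differential = (\<lambda>k. boundary),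
      summand = (\<lambda>k x. {c. Poly_Mapping.keys c \<subseteq> {xs \<in> order_chains r P k. xs \<noteq> [] \<and> hd xs = x}})\<rparr>"

section \<open>Synor complexes\<close>

text \<open>\<open>vectorspace.dim\<close> is meaningful only in finite dimension. For finite \<open>P\<close> both spaces whose
  dimensions are compared below are finite-dimensional: the first one is embedded by \<open>\<phi>\<close> into a
  space of chains of \<open>P\<close>.\<close>

definition synor_complex ::
  "'a rel \<Rightarrow> 'a set \<Rightarrow> ('k::field, 'v, 'a) graded_complex \<Rightarrow>
   (int \<Rightarrow> 'v \<Rightarrow> ('a list \<Rightarrow>\<^sub>0 'k)) \<Rightarrow> bool" where
  "synor_complex r P S \<phi> \<longleftrightarrow>
     is_strictly_graded r P S \<and>
     graded_chain_map P S (order_complex r P) \<phi> \<and>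
     (\<forall>i. inj_on (\<phi> i) (carrier (component S i))) \<and>
     (\<forall>x\<in>P. \<forall>i\<ge>0.
        vectorspace.dim class_ring ((component S i)\<lparr>carrier := summand S i x\<rparr>) =
        vectorspace.dim class_ring
          (homology (order_complex r (below r P x) :: ('k, _, 'a) graded_complex) (i - 1))) \<and>
     (\<forall>J. order_ideal r P J \<longrightarrow>
        induces_homology_iso (restrict_complex J S) (order_complex r J) \<phi>)"

end

theory Submission
  imports Defs
begin

text \<open>The complex is built inside the chain complex of \<open>P\<close>, with \<open>\<phi>\<close> the inclusion. By recursion on \<open>x\<close>,
  let \<open>J = P\<^bsub><x\<^esub>\<close> and choose a complement \<open>R x\<close> of the boundaries in the cycles of the subcomplex already
  constructed over \<open>J\<close>. The summand at \<open>x\<close> consists of the cones \<open>x * c\<close>, obtained by prepending \<open>x\<close> to the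
  chains of \<open>c \<in> R x\<close>. Since \<open>\<partial>(x * c) = c - x * \<partial>c = c\<close>, the differential is strictly graded, and the cones
  over \<open>R x\<close> are in bijection with the homology of \<open>J\<close> as soon as the subcomplex over \<open>J\<close> computes it.
  This holds because the quotient of the chains of an order ideal by the subcomplex is acyclic, by
  induction on the size of the ideal.\<close>

section \<open>Subspaces of spaces of finitely supported functions\<close>

abbreviation pscale :: "'k::field \<Rightarrow> ('b \<Rightarrow>\<^sub>0 'k) \<Rightarrow> 'b \<Rightarrow>\<^sub>0 'k" where
  "pscale a \<equiv> Poly_Mapping.map ((*) a)"

lemma lookup_pscale [simp]:
  "Poly_Mapping.lookup (pscale a c) b = a * Poly_Mapping.lookup c b"
  by (simp add: Poly_Mapping.map.rep_eq when_def)

interpretation pm: Vector_Spaces.vector_space "pscale :: 'k::field \<Rightarrow> ('b \<Rightarrow>\<^sub>0 'k) \<Rightarrow> _"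
  by unfold_locales (auto intro!: poly_mapping_eqI simp: lookup_add algebra_simps)

lemma keys_pscale_subset: "Poly_Mapping.keys (pscale a c) \<subseteq> Poly_Mapping.keys c"
  by (auto simp: in_keys_iff)

lemma pscale_single [simp]:
  "pscale a (Poly_Mapping.single b v) = Poly_Mapping.single b (a * v)"
  by (rule poly_mapping_eqI) (simp add: lookup_single when_def)

text \<open>Every chain space in the proof is a subspace of one ambient space of finitely supported
  functions, so only the carrier varies. Reusing the record of \<open>free_space\<close> keeps its
  dummy fields, so \<open>free_space X\<close> is literally of this form.\<close>

definition pm_space :: "('b \<Rightarrow>\<^sub>0 'k) set \<Rightarrow> ('k::field, 'b \<Rightarrow>\<^sub>0 'k) module" where
  "pm_space A = (free_space UNIV)\<lparr>carrier := A\<rparr>"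

lemma pm_space_simps [simp]:
  "carrier (pm_space A) = A"
  "add (pm_space A) = (+)"
  "zero (pm_space A) = 0"
  "smult (pm_space A) = pscale"
  "(pm_space A)\<lparr>carrier := B\<rparr> = pm_space B"
  by (simp_all add: pm_space_def free_space_def)

lemma free_space_eq_pm_space: "free_space X = pm_space {c. Poly_Mapping.keys c \<subseteq> X}"
  by (simp add: pm_space_def free_space_def)

lemma abelian_group_pm_space:
  assumes "pm.subspace A"
  shows "abelian_group (pm_space A)"
proof (rule abelian_groupI)
  show "\<And>x. x \<in> carrier (pm_space A) \<Longrightarrow> \<exists>y\<in>carrier (pm_space A). y \<oplus>\<^bsub>pm_space A\<^esub> x = \<zero>\<^bsub>pm_space A\<^esub>"
    using pm.subspace_neg[OF assms] by (auto intro!: bexI[of _ "- _"])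
qed (use assms in \<open>auto simp: pm.subspace_def add_ac\<close>)

lemma vectorspaceI:
  fixes V :: "('k::field, 'v) module"
  assumes "abelian_group V"
    and "\<And>a x. x \<in> carrier V \<Longrightarrow> a \<odot>\<^bsub>V\<^esub> x \<in> carrier V"
    and "\<And>a b x. x \<in> carrier V \<Longrightarrow> (a + b) \<odot>\<^bsub>V\<^esub> x = a \<odot>\<^bsub>V\<^esub> x \<oplus>\<^bsub>V\<^esub> b \<odot>\<^bsub>V\<^esub> x"
    and "\<And>a x y. x \<in> carrier V \<Longrightarrow> y \<in> carrier V \<Longrightarrow>
      a \<odot>\<^bsub>V\<^esub> (x \<oplus>\<^bsub>V\<^esub> y) = a \<odot>\<^bsub>V\<^esub> x \<oplus>\<^bsub>V\<^esub> a \<odot>\<^bsub>V\<^esub> y"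
    and "\<And>a b x. x \<in> carrier V \<Longrightarrow> (a * b) \<odot>\<^bsub>V\<^esub> x = a \<odot>\<^bsub>V\<^esub> (b \<odot>\<^bsub>V\<^esub> x)"
    and "\<And>x. x \<in> carrier V \<Longrightarrow> 1 \<odot>\<^bsub>V\<^esub> x = x"
  shows "vectorspace class_ring V"
proof -
  interpret K: field "class_ring :: 'k ring"
    by (rule class_field)
  interpret V: abelian_group V by fact
  show ?thesis
    by unfold_locales (use assms in \<open>auto simp: class_ring_simps\<close>)
qed

lemma vectorspace_pm_space:
  assumes "pm.subspace A"
  shows "vectorspace class_ring (pm_space A)"
  by (rule vectorspaceI[OF abelian_group_pm_space])
    (use assms in \<open>auto simp: pm.subspace_def pm.scale_left_distrib pm.scale_right_distrib\<close>)

lemma linear_mapI: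
  fixes V :: "('k::field, 'v) module" and W :: "('k, 'w) module"
  assumes "vectorspace class_ring V" "vectorspace class_ring W"
    and "\<And>x. x \<in> carrier V \<Longrightarrow> f x \<in> carrier W"
    and "\<And>x y. x \<in> carrier V \<Longrightarrow> y \<in> carrier V \<Longrightarrow> f (x \<oplus>\<^bsub>V\<^esub> y) = f x \<oplus>\<^bsub>W\<^esub> f y"
    and "\<And>a x. x \<in> carrier V \<Longrightarrow> f (a \<odot>\<^bsub>V\<^esub> x) = a \<odot>\<^bsub>W\<^esub> f x"
  shows "linear_map class_ring V W f"
proof (intro linear_map.intro mod_hom.intro mod_hom_axioms.intro)
  show "f \<in> LinearCombinations.module_hom class_ring V W"
    unfolding LinearCombinations.module_hom_def using assms(3-) by auto
qed (use assms(1,2) in \<open>simp_all add: vectorspace_def\<close>)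

lemma subspace_pm_space:
  assumes "pm.subspace A" "pm.subspace B" "B \<subseteq> A"
  shows "subspace class_ring B (pm_space A)"
proof -
  interpret A: vectorspace class_ring "pm_space A"
    using assms(1) by (rule vectorspace_pm_space)
  show ?thesis
    by unfold_locales (use assms in \<open>auto simp: pm.subspace_def\<close>)
qed

lemma finsum_pm_space:
  assumes "pm.subspace A" "finite Q" "\<And>x. x \<in> Q \<Longrightarrow> w x \<in> A"
  shows "finsum (pm_space A) w Q = (\<Sum>x\<in>Q. w x)"
proof -
  interpret A: abelian_group "pm_space A"
    using assms(1) by (rule abelian_group_pm_space)
  show ?thesis
    using assms(2,3)
  proof (induction Q)
    case (insert x Q)
    then show ?case by (subst A.finsum_insert) auto
  qed (simp add: A.finsum_empty)
qed

section \<open>Quotients\<close>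

definition pm_coset :: "('b \<Rightarrow>\<^sub>0 'k) set \<Rightarrow> ('b \<Rightarrow>\<^sub>0 'k) \<Rightarrow> ('b \<Rightarrow>\<^sub>0 'k::field) set" where
  "pm_coset B a = (\<lambda>b. b + a) ` B"

lemma a_r_coset_pm_space [simp]: "B +>\<^bsub>pm_space A\<^esub> a = pm_coset B a"
  by (auto simp: a_r_coset_def r_coset_def pm_coset_def)

lemma pm_coset_self: "pm.subspace B \<Longrightarrow> a \<in> pm_coset B a"
  using pm.subspace_0 by (force simp: pm_coset_def)

lemma mem_pm_coset_iff: "c \<in> pm_coset B a \<longleftrightarrow> c - a \<in> B"
  by (force simp: pm_coset_def image_iff)

lemma pm_coset_eq_iff:
  assumes "pm.subspace B"
  shows "pm_coset B a = pm_coset B c \<longleftrightarrow> a - c \<in> B"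
proof
  assume "a - c \<in> B"
  then have "x - a \<in> B \<longleftrightarrow> x - c \<in> B" for x
    using pm.subspace_add[OF assms, of "x - a" "a - c"] pm.subspace_diff[OF assms, of "x - c" "a - c"]
    by auto
  then show "pm_coset B a = pm_coset B c"
    by (auto simp: mem_pm_coset_iff)
qed (use pm_coset_self[OF assms, of a] in \<open>simp add: mem_pm_coset_iff\<close>)

definition pm_quotient :: "('b \<Rightarrow>\<^sub>0 'k) set \<Rightarrow> ('b \<Rightarrow>\<^sub>0 'k) set \<Rightarrow> ('k::field, ('b \<Rightarrow>\<^sub>0 'k) set) module" where
  "pm_quotient A B = quotient_space (pm_space A) B"

lemma carrier_pm_quotient [simp]: "carrier (pm_quotient A B) = pm_coset B ` A"
  by (auto simp: pm_quotient_def quotient_space_def A_RCOSETS_def' a_r_coset_pm_space[simplified])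

lemma zero_pm_quotient: "zero (pm_quotient A B) = pm_coset B 0"
  by (simp add: pm_quotient_def quotient_space_def pm_coset_def)

lemma add_pm_quotient:
  assumes "pm.subspace B"
  shows "pm_coset B a \<oplus>\<^bsub>pm_quotient A B\<^esub> pm_coset B c = pm_coset B (a + c)"
proof -
  have "\<exists>b\<in>B. \<exists>b'\<in>B. x + (a + c) = b + a + (b' + c)" if "x \<in> B" for x
    using that pm.subspace_0[OF assms] by (intro bexI[of _ x] bexI[of _ 0]) auto
  moreover have "\<exists>x\<in>B. b + a + (b' + c) = x + (a + c)" if "b \<in> B" "b' \<in> B" for b b'
    using that pm.subspace_add[OF assms] by (intro bexI[of _ "b + b'"]) (auto simp: add_ac)
  ultimately show ?thesis
    by (auto simp: pm_quotient_def quotient_space_def set_add_def set_mult_def pm_coset_def image_iff)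
qed

text \<open>Scalar multiplication on the quotient is a union over all representatives of a class;
  they all yield the same coset, and the class is nonempty.\<close>

lemma smult_pm_quotient:
  assumes "pm.subspace B"
  shows "a \<odot>\<^bsub>pm_quotient A B\<^esub> pm_coset B c = pm_coset B (pscale a c)"
proof -
  have "pm_coset B (pscale a v) = pm_coset B (pscale a c)" if "v \<in> pm_coset B c" for v
  proof -
    have "pscale a (v - c) \<in> B"
      using that by (intro pm.subspace_scale[OF assms]) (simp add: mem_pm_coset_iff)
    then show ?thesis
      unfolding pm_coset_eq_iff[OF assms] pm.scale_right_diff_distrib .
  qed
  then have "(\<Union>v\<in>pm_coset B c. pm_coset B (pscale a v)) = (\<Union>v\<in>pm_coset B c. pm_coset B (pscale a c))"
    by (rule SUP_cong[OF refl])
  also have "\<dots> = pm_coset B (pscale a c)"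
    using pm_coset_self[OF assms, of c] by blast
  finally show ?thesis
    by (simp add: pm_quotient_def quotient_space_def)
qed

lemma vectorspace_pm_quotient:
  assumes "pm.subspace A" "pm.subspace B"
  shows "vectorspace class_ring (pm_quotient A B)"
proof (rule vectorspaceI)
  note A = pm.subspace_0[OF assms(1)] pm.subspace_add[OF assms(1)]
  note quot = add_pm_quotient[OF assms(2)] smult_pm_quotient[OF assms(2)] zero_pm_quotient
  show "abelian_group (pm_quotient A B)"
  proof (rule abelian_groupI)
    fix x assume "x \<in> carrier (pm_quotient A B)"
    then obtain a where "a \<in> A" "x = pm_coset B a" by auto
    then show "\<exists>y\<in>carrier (pm_quotient A B). y \<oplus>\<^bsub>pm_quotient A B\<^esub> x = \<zero>\<^bsub>pm_quotient A B\<^esub>"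
      using pm.subspace_neg[OF assms(1)] by (auto simp: quot intro!: bexI[of _ "- a"])
  qed (auto simp: quot A ac_simps)
qed (auto simp: add_pm_quotient[OF assms(2)] smult_pm_quotient[OF assms(2)]
  pm.subspace_scale[OF assms(1)] pm.scale_left_distrib pm.scale_right_distrib)

lemma linear_map_pm_quotient:
  assumes "pm.subspace A" "pm.subspace A'" "pm.subspace B'"
    and "\<And>a. a \<in> A \<Longrightarrow> f a \<in> A'"
    and "\<And>a c. f (a + c) = f a + f c" "\<And>k a. f (pscale k a) = pscale k (f a)"
  shows "linear_map class_ring (pm_space A) (pm_quotient A' B') (\<lambda>a. pm_coset B' (f a))"
  by (rule linear_mapI)
    (use assms in \<open>auto simp: vectorspace_pm_space vectorspace_pm_quotient add_pm_quotient smult_pm_quotient\<close>)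

text \<open>Representatives that differ by an element of \<open>B\<close> also agree modulo
  \<open>B'\<close>, so the union collapses to one coset. This evaluates the union in
  \<open>induced_map\<close>.\<close>

lemma UN_pm_coset:
  assumes "pm.subspace B" "pm.subspace B'" "B \<subseteq> B'"
  shows "(\<Union>c\<in>pm_coset B a. pm_coset B' c) = pm_coset B' a"
proof -
  have "pm_coset B' c = pm_coset B' a" if "c \<in> pm_coset B a" for c
    using that assms by (auto simp: pm_coset_eq_iff mem_pm_coset_iff)
  then have "(\<Union>c\<in>pm_coset B a. pm_coset B' c) = (\<Union>c\<in>pm_coset B a. pm_coset B' a)"
    by (rule SUP_cong[OF refl])
  then show ?thesis
    using pm_coset_self[OF assms(1), of a] by blast
qed

text \<open>Here \<open>inj\<close> says that the kernel of the induced map is trivial, and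
  \<open>surj\<close> that every class of the target has a representative in \<open>A\<close>. With
  cycles and boundaries inserted, these are the two facts to verify for a homology
  isomorphism.\<close>

lemma quotient_map_inclusion:
  assumes "pm.subspace A" "pm.subspace B" "pm.subspace A'" "pm.subspace B'"
    and "A \<subseteq> A'" "B \<subseteq> B'"
    and inj: "A \<inter> B' \<subseteq> B" and surj: "\<And>c. c \<in> A' \<Longrightarrow> \<exists>a\<in>A. c - a \<in> B'"
  shows "linear_map class_ring (pm_quotient A B) (pm_quotient A' B') (\<lambda>X. \<Union>c\<in>X. pm_coset B' c)"
    and "bij_betw (\<lambda>X. \<Union>c\<in>X. pm_coset B' c) (carrier (pm_quotient A B)) (carrier (pm_quotient A' B'))"
proof -
  define g where "g X = (\<Union>c\<in>X. pm_coset B' c)" for X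
  have g: "g (pm_coset B a) = pm_coset B' a" for a
    unfolding g_def by (rule UN_pm_coset[OF assms(2,4,6)])
  have "linear_map class_ring (pm_quotient A B) (pm_quotient A' B') g"
    by (rule linear_mapI) (use assms(1-5) in
      \<open>auto simp: g vectorspace_pm_quotient add_pm_quotient smult_pm_quotient\<close>)
  then show "linear_map class_ring (pm_quotient A B) (pm_quotient A' B') (\<lambda>X. \<Union>c\<in>X. pm_coset B' c)"
    unfolding g_def .
  have "bij_betw g (carrier (pm_quotient A B)) (carrier (pm_quotient A' B'))"
    unfolding bij_betw_def
  proof
    show "inj_on g (carrier (pm_quotient A B))"
      using inj pm.subspace_diff[OF assms(1)]
      by (auto simp: inj_on_def g pm_coset_eq_iff assms(2,4))
    have "\<exists>a\<in>A. pm_coset B' c = pm_coset B' a" if "c \<in> A'" for c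
      using surj[OF that] by (auto simp: pm_coset_eq_iff assms(4))
    then show "g ` carrier (pm_quotient A B) = carrier (pm_quotient A' B')"
      using assms(5) by (auto simp: image_image g image_iff)
  qed
  then show "bij_betw (\<lambda>X. \<Union>c\<in>X. pm_coset B' c) (carrier (pm_quotient A B)) (carrier (pm_quotient A' B'))"
    unfolding g_def .
qed

section \<open>Dimension and complements\<close>

text \<open>Both directions use minimality of spans: the preimage of the span of \<open>T\<close>
  A\<open>is a submodule containing\<close>A\<open>, and the image of the span of\<close>A\<open>is a submodule containing\<close>T
  \<open>A\<close>. Surjectivity of \<open>T\<close> finishes the first direction, injectivity the
  second.\<close>

lemma (in linear_map) gen_set_image_iff:
  assumes bij: "bij_betw T (carrier V) (carrier W)" and A: "A \<subseteq> carrier V"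
  shows "V.module.span A = carrier V \<longleftrightarrow> W.module.span (T ` A) = carrier W"
proof
  have TA: "T ` A \<subseteq> carrier W"
    using A T_im by blast
  note spA = V.module.span_is_submodule[OF A] and spTA = W.module.span_is_submodule[OF TA]
  have A_sub: "V.module.span A \<subseteq> carrier V" and TA_sub: "W.module.span (T ` A) \<subseteq> carrier W"
    using spA spTA by (simp_all add: submodule.subset)
  {
    assume gen: "V.module.span A = carrier V"
    let ?N = "{v \<in> carrier V. T v \<in> W.module.span (T ` A)}"
    have "submodule K ?N V"
      by (intro submodule.intro)
        (use V.module.module_axioms in \<open>simp_all add: submodule.m_closed[OF spTA]
          submodule.zero_closed[OF spTA] submodule.smult_closed[OF spTA]\<close>)
    moreover have "A \<subseteq> ?N"
      using A W.module.in_own_span[OF TA] by blast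
    ultimately have "V.module.span A \<subseteq> ?N"
      by (intro V.module.span_is_subset)
    then have "T ` carrier V \<subseteq> W.module.span (T ` A)"
      unfolding gen by blast
    then show "W.module.span (T ` A) = carrier W"
      using bij_betw_imp_surj_on[OF bij] TA_sub by simp
  next
    assume gen: "W.module.span (T ` A) = carrier W"
    let ?N = "T ` V.module.span A"
    have "submodule K ?N W"
    proof (rule submodule.intro)
      show "?N \<subseteq> carrier W"
        using A_sub T_im by blast
    next
      fix v w assume "v \<in> ?N" "w \<in> ?N"
      then obtain a b where ab: "a \<in> V.module.span A" "b \<in> V.module.span A" "v = T a" "w = T b"
        by blast
      then have "v \<oplus>\<^bsub>W\<^esub> w = T (a \<oplus>\<^bsub>V\<^esub> b)"
        using A_sub by (simp add: subsetD)
      then show "v \<oplus>\<^bsub>W\<^esub> w \<in> ?N"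
        using submodule.m_closed[OF spA ab(1,2)] by (rule image_eqI)
    next
      show "\<zero>\<^bsub>W\<^esub> \<in> ?N"
        using f0_is_0[symmetric] submodule.zero_closed[OF spA] by (rule image_eqI)
    next
      fix c v assume c: "c \<in> carrier K" and "v \<in> ?N"
      then obtain a where a: "a \<in> V.module.span A" "v = T a"
        by blast
      then have "c \<odot>\<^bsub>W\<^esub> v = T (c \<odot>\<^bsub>V\<^esub> a)"
        using A_sub c by (simp add: subsetD)
      then show "c \<odot>\<^bsub>W\<^esub> v \<in> ?N"
        using submodule.smult_closed[OF spA c a(1)] by (rule image_eqI)
    qed (rule W.module.module_axioms)
    moreover have "T ` A \<subseteq> ?N"
      using V.module.in_own_span[OF A] by blast
    ultimately have "W.module.span (T ` A) \<subseteq> ?N"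
      by (intro W.module.span_is_subset)
    then have "T ` carrier V \<subseteq> T ` V.module.span A"
      unfolding gen bij_betw_imp_surj_on[OF bij] .
    then have "carrier V \<subseteq> V.module.span A"
      using inj_on_image_mem_iff[OF bij_betw_imp_inj_on[OF bij] _ A_sub] by blast
    with A_sub show "V.module.span A = carrier V"
      by simp
  }
qed

text \<open>\<open>dim\<close> is the least size of a finite generating set, so it suffices that
  both spaces have finite generating sets of the same sizes.\<close>

lemma (in linear_map) dim_eq_of_bij:
  assumes bij: "bij_betw T (carrier V) (carrier W)"
  shows "V.dim = W.dim"
proof -
  have "(\<exists>A. finite A \<and> card A = n \<and> A \<subseteq> carrier V \<and> V.module.span A = carrier V) \<longleftrightarrow>
      (\<exists>A. finite A \<and> card A = n \<and> A \<subseteq> carrier W \<and> W.module.span A = carrier W)" for n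
  proof
    assume "\<exists>A. finite A \<and> card A = n \<and> A \<subseteq> carrier V \<and> V.module.span A = carrier V"
    then obtain A where A: "finite A" "card A = n" "A \<subseteq> carrier V" "V.module.span A = carrier V" by blast
    moreover have "card (T ` A) = card A"
      using bij A(3) by (intro card_image) (auto simp: bij_betw_def intro: inj_on_subset)
    ultimately show "\<exists>A. finite A \<and> card A = n \<and> A \<subseteq> carrier W \<and> W.module.span A = carrier W"
      using gen_set_image_iff[OF bij A(3)] by (intro exI[of _ "T ` A"]) auto
  next
    assume "\<exists>A. finite A \<and> card A = n \<and> A \<subseteq> carrier W \<and> W.module.span A = carrier W"
    then obtain B where B: "finite B" "card B = n" "B \<subseteq> carrier W" "W.module.span B = carrier W" by blast
    have "B \<subseteq> T ` carrier V"
      using bij B(3) by (simp add: bij_betw_def)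
    then obtain A where A: "A \<subseteq> carrier V" "B = T ` A"
      by (rule subset_imageE)
    have "inj_on T A"
      using bij A(1) by (auto simp: bij_betw_def intro: inj_on_subset)
    then show "\<exists>A. finite A \<and> card A = n \<and> A \<subseteq> carrier V \<and> V.module.span A = carrier V"
      using A B gen_set_image_iff[OF bij A(1)]
      by (intro exI[of _ A]) (auto simp: card_image finite_image_iff)
  qed
  then show ?thesis
    by (simp add: V.dim_def W.dim_def)
qed

text \<open>A basis \<open>b\<close> of \<open>B\<close> is extended to a basis \<open>c\<close> of
  \<open>Z\<close>; the complement is the span of \<open>c - b\<close>.\<close>

lemma (in Vector_Spaces.vector_space) subspace_complement_exists:
  assumes "subspace Z" "subspace B" "B \<subseteq> Z"
  shows "\<exists>R. subspace R \<and> R \<subseteq> Z \<and> R \<inter> B = {0} \<and> (\<forall>z\<in>Z. \<exists>y\<in>R. z - y \<in> B)"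
proof -
  obtain b where b: "b \<subseteq> B" "independent b" "B \<subseteq> span b"
    using maximal_independent_subset by blast
  obtain c where c: "b \<subseteq> c" "c \<subseteq> Z" "independent c" "Z \<subseteq> span c"
    using maximal_independent_subset_extend[of b Z] b assms(3) by blast
  have Bspan: "B = span b"
    using b span_minimal[OF b(1) assms(2)] by auto
  show ?thesis
  proof (intro exI conjI ballI)
    show "span (c - b) \<subseteq> Z"
      using c(2) by (intro span_minimal assms) auto
    \<comment> \<open>The coordinates of \<open>x\<close> with respect to \<open>c\<close> are
      supported both in \<open>c - b\<close> and in \<open>b\<close>, hence all vanish.\<close>
    have "x = 0" if "x \<in> span (c - b)" "x \<in> span b" for x
    proof -
      have "representation c x = representation (c - b) x"
        using c that by (intro representation_extend) auto
      moreover have "representation c x = representation b x"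
        using c that by (intro representation_extend) auto
      ultimately have "representation c x v = 0" for v
        using representation_ne_zero[of b x v] representation_ne_zero[of "c - b" x v] by auto
      then show "x = 0"
        using sum_nonzero_representation_eq[OF c(3), of x] c that by (auto intro: span_mono[THEN subsetD])
    qed
    then show "span (c - b) \<inter> B = {0}"
      using Bspan span_zero by auto
    fix z assume "z \<in> Z"
    then have "z \<in> span ((c - b) \<union> b)"
      using c by (metis Un_Diff_cancel2 sup.absorb1 subsetD)
    then show "\<exists>y\<in>span (c - b). z - y \<in> B"
      unfolding span_Un Bspan by force
  qed simp
qed

section \<open>Boundary, cone and link\<close>

text \<open>A finitely supported function is a finite sum of singles. Since the coefficient
  \<open>v\<close> is arbitrary, additivity reduces the equality to singles.\<close>

lemma additive_eqI:
  fixes f g :: "('b \<Rightarrow>\<^sub>0 'k::field) \<Rightarrow> 'c::ab_group_add"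
  assumes f: "\<And>c d. f (c + d) = f c + f d" and g: "\<And>c d. g (c + d) = g c + g d"
    and eq: "\<And>b v. f (Poly_Mapping.single b v) = g (Poly_Mapping.single b v)"
  shows "f c = g c"
proof -
  have "f 0 = 0" "g 0 = 0"
    using f[of 0 0] g[of 0 0] by simp_all
  then have "f (\<Sum>b\<in>X. Poly_Mapping.single b (h b)) = g (\<Sum>b\<in>X. Poly_Mapping.single b (h b))" for X h
    by (induction X rule: infinite_finite_induct) (simp_all add: f g eq)
  moreover have "c = (\<Sum>b\<in>Poly_Mapping.keys c. Poly_Mapping.single b (Poly_Mapping.lookup c b))"
    by (rule poly_mapping_eqI) (simp add: lookup_sum lookup_single when_def in_keys_iff)
  ultimately show ?thesis
    by metis
qed

text \<open>Summing over a common finite superset of the supports makes the boundaries of different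
  chains comparable term by term.\<close>

lemma boundary_superset:
  assumes "finite X" "Poly_Mapping.keys c \<subseteq> X"
  shows "boundary c = (\<Sum>xs\<in>X. \<Sum>j<length xs.
     Poly_Mapping.single (take j xs @ drop (Suc j) xs) ((-1) ^ j * Poly_Mapping.lookup c xs))"
  unfolding boundary_def using assms
  by (intro sum.mono_neutral_left) (auto simp: in_keys_iff)

lemma boundary_add: "boundary (c + d) = boundary c + boundary d"
proof -
  define X where "X = Poly_Mapping.keys c \<union> Poly_Mapping.keys d"
  have X: "finite X" "Poly_Mapping.keys (c + d) \<subseteq> X" "Poly_Mapping.keys c \<subseteq> X" "Poly_Mapping.keys d \<subseteq> X"
    using Poly_Mapping.keys_add[of c d] by (auto simp: X_def)
  show ?thesis
    by (simp add: boundary_superset[OF X(1,2)] boundary_superset[OF X(1,3)]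
        boundary_superset[OF X(1,4)] lookup_add distrib_left single_add sum.distrib)
qed

lemma boundary_pscale: "boundary (pscale a c) = pscale a (boundary c)"
  unfolding boundary_superset[OF finite_keys keys_pscale_subset] boundary_def[of c]
  by (simp add: pm.scale_sum_right mult.left_commute)

lemma boundary_0 [simp]: "boundary 0 = 0"
  by (simp add: boundary_def)

lemma boundary_diff: "boundary (c - d) = boundary c - boundary d"
  using boundary_add[of "c - d" d] by (simp add: eq_diff_eq)

lemma boundary_sum: "boundary (\<Sum>x\<in>X. f x) = (\<Sum>x\<in>X. boundary (f x))"
  by (induction X rule: infinite_finite_induct) (simp_all add: boundary_add)

lemma boundary_single:
  "boundary (Poly_Mapping.single xs a) =
    (\<Sum>j<length xs. Poly_Mapping.single (take j xs @ drop (Suc j) xs) ((-1) ^ j * a))"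
  by (subst boundary_superset[of "{xs}"]) auto

definition cone :: "'a \<Rightarrow> ('a list \<Rightarrow>\<^sub>0 'k) \<Rightarrow> ('a list \<Rightarrow>\<^sub>0 'k::field)" where
  "cone x c = (\<Sum>xs\<in>Poly_Mapping.keys c. Poly_Mapping.single (x # xs) (Poly_Mapping.lookup c xs))"

text \<open>A left inverse of \<open>cone x\<close>: it keeps the chains of \<open>c\<close> that
  begin with \<open>x\<close> and removes this head. It thus reads off the coefficient of
  \<open>x\<close> in the decomposition of \<open>c\<close> by largest elements.\<close>

abbreviation link :: "'a \<Rightarrow> ('a list \<Rightarrow>\<^sub>0 'k) \<Rightarrow> ('a list \<Rightarrow>\<^sub>0 'k::field)" where
  "link x \<equiv> Poly_Mapping.map_key (Cons x)"

lemma lookup_link [simp]: "Poly_Mapping.lookup (link x c) xs = Poly_Mapping.lookup c (x # xs)"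
  by (simp add: map_key.rep_eq)

lemma lookup_cone:
  "Poly_Mapping.lookup (cone x c) ys =
    (case ys of [] \<Rightarrow> 0 | y # zs \<Rightarrow> if y = x then Poly_Mapping.lookup c zs else 0)"
  by (auto simp: cone_def lookup_sum lookup_single when_def in_keys_iff split: list.split)

lemma lookup_cone_simps [simp]:
  "Poly_Mapping.lookup (cone x c) [] = 0"
  "Poly_Mapping.lookup (cone x c) (y # ys) = (if y = x then Poly_Mapping.lookup c ys else 0)"
  by (simp_all add: lookup_cone)

lemma list_poly_mapping_eqI:
  assumes "Poly_Mapping.lookup c [] = Poly_Mapping.lookup d []"
    and "\<And>y ys. Poly_Mapping.lookup c (y # ys) = Poly_Mapping.lookup d (y # ys)"
  shows "c = d"
proof (rule poly_mapping_eqI)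
  show "Poly_Mapping.lookup c ys = Poly_Mapping.lookup d ys" for ys
    using assms by (cases ys) auto
qed

lemma cone_add: "cone x (c + d) = cone x c + cone x d"
  by (rule list_poly_mapping_eqI) (simp_all add: lookup_add)

lemma cone_pscale: "cone x (pscale a c) = pscale a (cone x c)"
  by (rule list_poly_mapping_eqI) simp_all

lemma cone_0 [simp]: "cone x 0 = 0"
  by (rule list_poly_mapping_eqI) simp_all

lemma cone_single [simp]: "cone x (Poly_Mapping.single xs a) = Poly_Mapping.single (x # xs) a"
  by (rule list_poly_mapping_eqI) (simp_all add: lookup_single when_def)

lemma link_add: "link x (c + d) = link x c + link x d"
  by (rule poly_mapping_eqI) (simp add: lookup_add)

lemma link_diff: "link x (c - d) = link x c - link x d"
  by (rule poly_mapping_eqI) (simp add: lookup_minus)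

lemma link_pscale: "link x (pscale a c) = pscale a (link x c)"
  by (rule poly_mapping_eqI) simp

lemma link_cone [simp]: "link x (cone y c) = (if x = y then c else 0)"
  by (rule poly_mapping_eqI) simp

text \<open>Deleting the new head \<open>x\<close> returns \<open>c\<close>. Deleting a later entry
  is a deletion in \<open>c\<close> with the index raised by one, which flips the sign.\<close>

lemma boundary_cone: "boundary (cone x c) = c - cone x (boundary c)"
proof (rule additive_eqI[where c = c])
  fix xs :: "'a list" and a :: 'b
  have cone_sum: "cone x (\<Sum>j<n. f j) = (\<Sum>j<n. cone x (f j))" for n :: nat and f :: "nat \<Rightarrow> _ \<Rightarrow>\<^sub>0 'b"
    by (induction n) (simp_all add: cone_add)
  show "boundary (cone x (Poly_Mapping.single xs a)) =
      Poly_Mapping.single xs a - cone x (boundary (Poly_Mapping.single xs a))"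
    by (simp add: boundary_single cone_sum sum.lessThan_Suc_shift single_uminus sum_negf del: sum.lessThan_Suc)
qed (simp_all add: cone_add boundary_add)

text \<open>Induction along the list: a nonempty list is a cone, and applying the cone formula twice
  turns its double boundary into the cone over the double boundary of the tail.\<close>

lemma boundary_boundary [simp]: "boundary (boundary c) = 0"
proof (rule additive_eqI[where c = c])
  fix xs :: "'a list" and a :: 'b
  show "boundary (boundary (Poly_Mapping.single xs a)) = 0"
  proof (induction xs)
    case (Cons x xs)
    then show ?case
      unfolding cone_single[symmetric] boundary_cone boundary_diff by simp
  qed (simp add: boundary_single)
qed (simp_all add: boundary_add)

lemma subspace_cycles:
  fixes A :: "('a list \<Rightarrow>\<^sub>0 'k::field) set"
  shows "pm.subspace A \<Longrightarrow> pm.subspace {c \<in> A. boundary c = 0}"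
  by (auto simp: pm.subspace_def boundary_add boundary_pscale)

lemma subspace_boundaries:
  fixes A :: "('a list \<Rightarrow>\<^sub>0 'k::field) set"
  assumes "pm.subspace A"
  shows "pm.subspace (boundary ` A)"
  using assms unfolding pm.subspace_def
  by (auto simp: boundary_add[symmetric] boundary_pscale[symmetric] intro: image_eqI[of _ _ 0])

section \<open>Order chains\<close>

definition poset_chains :: "'a rel \<Rightarrow> 'a set \<Rightarrow> int \<Rightarrow> ('a list \<Rightarrow>\<^sub>0 'k::field) set" where
  "poset_chains r J i = {c. Poly_Mapping.keys c \<subseteq> order_chains r J i}"

lemma poset_chains_iff:
  "c \<in> poset_chains r J i \<longleftrightarrow> (\<forall>xs. Poly_Mapping.lookup c xs \<noteq> 0 \<longrightarrow> xs \<in> order_chains r J i)"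
  by (auto simp: poset_chains_def in_keys_iff)

lemma subspace_keys_subset: "pm.subspace {c. Poly_Mapping.keys c \<subseteq> X}"
  unfolding pm.subspace_def
  by (auto dest: subsetD[OF Poly_Mapping.keys_add] subsetD[OF keys_pscale_subset])

lemma subspace_poset_chains: "pm.subspace (poset_chains r J i)"
  unfolding poset_chains_def by (rule subspace_keys_subset)

lemma Cons_order_chains_iff:
  "x # xs \<in> order_chains r J i \<longleftrightarrow> x \<in> J \<and> xs \<in> order_chains r (below r J x) (i - 1)"
  by (auto simp: order_chains_def below_def)

lemma order_chains_mono: "J \<subseteq> J' \<Longrightarrow> order_chains r J i \<subseteq> order_chains r J' i"
  by (auto simp: order_chains_def)

lemma poset_chains_mono: "J \<subseteq> J' \<Longrightarrow> poset_chains r J i \<subseteq> poset_chains r J' i"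
  using order_chains_mono[of J J' r i] by (auto simp: poset_chains_def)

lemma poset_chains_less: "i < -1 \<Longrightarrow> poset_chains r J i = {0}"
  by (auto simp: poset_chains_def order_chains_def)

lemma poset_chains_minus_one: "poset_chains r J (-1) = range (\<lambda>a. Poly_Mapping.single [] a)"
proof -
  have "order_chains r J (-1) = {[]}"
    by (auto simp: order_chains_def)
  moreover have "c = Poly_Mapping.single [] (Poly_Mapping.lookup c [])"
    if "Poly_Mapping.keys c \<subseteq> {[]}" for c :: "'a list \<Rightarrow>\<^sub>0 'k::field"
    using that by (intro poly_mapping_eqI) (auto simp: lookup_single when_def in_keys_iff)
  ultimately show ?thesis
    by (auto simp: poset_chains_def split: if_splits)
qed

lemma order_chains_delete:
  assumes "xs \<in> order_chains r J i" "j < length xs"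
  shows "take j xs @ drop (Suc j) xs \<in> order_chains r J (i - 1)"
  using assms(1)
  by (subst (asm) id_take_nth_drop[OF assms(2)])
    (use assms(2) in \<open>auto simp: order_chains_def sorted_wrt_append\<close>)

lemma boundary_in_poset_chains:
  assumes "c \<in> poset_chains r J i"
  shows "boundary c \<in> poset_chains r J (i - 1)"
  unfolding boundary_def
proof (intro pm.subspace_sum[OF subspace_poset_chains])
  fix xs j assume "xs \<in> Poly_Mapping.keys c" "j \<in> {..<length xs}"
  then have "take j xs @ drop (Suc j) xs \<in> order_chains r J (i - 1)"
    using assms by (intro order_chains_delete) (auto simp: poset_chains_def)
  then show "Poly_Mapping.single (take j xs @ drop (Suc j) xs) ((- 1) ^ j * Poly_Mapping.lookup c xs)
      \<in> poset_chains r J (i - 1)"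
    by (auto simp: poset_chains_def)
qed

lemma cone_in_poset_chains:
  assumes "c \<in> poset_chains r (below r J x) i" "x \<in> J"
  shows "cone x c \<in> poset_chains r J (i + 1)"
  unfolding poset_chains_iff
proof (intro allI impI)
  fix ys assume "Poly_Mapping.lookup (cone x c) ys \<noteq> 0"
  then show "ys \<in> order_chains r J (i + 1)"
    using assms by (cases ys) (auto simp: poset_chains_iff Cons_order_chains_iff split: if_splits)
qed

lemma link_in_poset_chains:
  assumes "c \<in> poset_chains r J i"
  shows "link x c \<in> poset_chains r (below r J x) (i - 1)"
  using assms by (auto simp: poset_chains_iff Cons_order_chains_iff)

lemma link_eq_0:
  assumes "c \<in> poset_chains r J i" "x \<notin> J"
  shows "link x c = 0"
  using assms by (intro poly_mapping_eqI) (auto simp: poset_chains_iff Cons_order_chains_iff)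

text \<open>Each nonempty chain has exactly one head. The bound on \<open>i\<close> excludes the
  empty chain, which has none.\<close>

lemma sum_cone_link:
  assumes "c \<in> poset_chains r J i" "finite J" "i \<ge> 0"
  shows "c = (\<Sum>x\<in>J. cone x (link x c))"
proof (rule list_poly_mapping_eqI)
  have "[] \<notin> order_chains r J i"
    using assms(3) by (auto simp: order_chains_def)
  then show "Poly_Mapping.lookup c [] = Poly_Mapping.lookup (\<Sum>x\<in>J. cone x (link x c)) []"
    using assms(1) by (auto simp: poset_chains_iff lookup_sum)
  show "Poly_Mapping.lookup c (y # ys) = Poly_Mapping.lookup (\<Sum>x\<in>J. cone x (link x c)) (y # ys)" for y ys
    using assms(1,2) by (auto simp: poset_chains_iff lookup_sum Cons_order_chains_iff)
qed

section \<open>The subcomplex spanned by cones over homology representatives\<close>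

text \<open>Membership is phrased through coefficients rather than as a sum of cones, so that it
  visibly depends only on the values of \<open>R\<close> on \<open>J\<close>. In degrees at least 0
  and for valid \<open>R\<close> it is the direct sum of the cones over the
  \<open>R x\<close>.\<close>

definition synor_chains ::
  "'a rel \<Rightarrow> ('a \<Rightarrow> int \<Rightarrow> ('a list \<Rightarrow>\<^sub>0 'k) set) \<Rightarrow> 'a set \<Rightarrow> int \<Rightarrow> ('a list \<Rightarrow>\<^sub>0 'k::field) set" where
  "synor_chains r R J i = {c \<in> poset_chains r J i. \<forall>x\<in>J. link x c \<in> R x (i - 1)}"

text \<open>In each degree \<open>\<rho>\<close> is a complement of the boundaries in the cycles of
  the subcomplex over \<open>J\<close>. It is kept apart from \<open>R\<close> because in the
  recursion \<open>R\<close> holds the earlier choices and \<open>\<rho>\<close> is the candidate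
  for the next one.\<close>

definition represents_homology ::
  "'a rel \<Rightarrow> 'a set \<Rightarrow> ('a \<Rightarrow> int \<Rightarrow> ('a list \<Rightarrow>\<^sub>0 'k) set) \<Rightarrow> (int \<Rightarrow> ('a list \<Rightarrow>\<^sub>0 'k::field) set) \<Rightarrow> bool" where
  "represents_homology r J R \<rho> \<longleftrightarrow>
     (\<forall>i. pm.subspace (\<rho> i) \<and>
          \<rho> i \<subseteq> {c \<in> synor_chains r R J i. boundary c = 0} \<and>
          \<rho> i \<inter> boundary ` synor_chains r R J (i + 1) = {0} \<and>
          (\<forall>z\<in>{c \<in> synor_chains r R J i. boundary c = 0}.
             \<exists>y\<in>\<rho> i. z - y \<in> boundary ` synor_chains r R J (i + 1)))"

lemma synor_chains_subset: "synor_chains r R J i \<subseteq> poset_chains r J i"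
  by (auto simp: synor_chains_def)

lemma subspace_synor_chains:
  assumes "\<And>x. x \<in> J \<Longrightarrow> pm.subspace (R x (i - 1))"
  shows "pm.subspace (synor_chains r R J i)"
  using subspace_poset_chains[of r J i] assms
  by (auto simp: pm.subspace_def synor_chains_def link_add link_pscale)

lemma synor_chains_mono:
  assumes "J \<subseteq> J'" "\<And>x. x \<in> J' \<Longrightarrow> pm.subspace (R x (i - 1))"
  shows "synor_chains r R J i \<subseteq> synor_chains r R J' i"
proof
  fix c assume c: "c \<in> synor_chains r R J i"
  have "link x c \<in> R x (i - 1)" if "x \<in> J'" for x
  proof (cases "x \<in> J")
    case False
    then have "link x c = 0"
      using c by (intro link_eq_0) (auto simp: synor_chains_def)
    then show ?thesis
      using pm.subspace_0[OF assms(2)[OF that]] by simp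
  qed (use c in \<open>auto simp: synor_chains_def\<close>)
  then show "c \<in> synor_chains r R J' i"
    using c poset_chains_mono[OF assms(1)] by (auto simp: synor_chains_def)
qed

lemma synor_chains_cong:
  "(\<And>x. x \<in> J \<Longrightarrow> R x = R' x) \<Longrightarrow> synor_chains r R J i = synor_chains r R' J i"
  by (simp add: synor_chains_def)

section \<open>Recursive choice of homology representatives\<close>

locale finite_poset =
  fixes P :: "'a set" and r :: "'a rel"
  assumes finP: "finite P" and po: "partial_order_on P r"
begin

lemma below_subset_ideal:
  "order_ideal r P J \<Longrightarrow> x \<in> J \<Longrightarrow> below r P x \<subseteq> J"
  by (auto simp: order_ideal_def below_def)

lemma below_ideal_eq:
  "order_ideal r P J \<Longrightarrow> x \<in> J \<Longrightarrow> below r J x = below r P x"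
  by (auto simp: order_ideal_def below_def)

lemma order_ideal_below: "order_ideal r P (below r P x)"
  using po unfolding order_ideal_def below_def
  by (auto dest: partial_order_onD transD antisymD)

text \<open>Representatives are cycles, so the boundary of each cone is its base. In negative
  degrees the index set on the right is empty, matching a boundary that lands below degree
  -1.\<close>

lemma boundary_synor_chains_eq:
  assumes J: "order_ideal r P J" and c: "c \<in> synor_chains r R J i"
    and R: "\<And>x. x \<in> J \<Longrightarrow> represents_homology r (below r P x) R (R x)"
  shows "boundary c = (\<Sum>x\<in>{x\<in>J. i \<ge> 0}. link x c)"
proof (cases "i \<ge> 0")
  case True
  have finJ: "finite J"
    using J finP by (auto simp: order_ideal_def intro: finite_subset)
  have "boundary (cone x (link x c)) = link x c" if "x \<in> J" for x
  proof -
    have "link x c \<in> R x (i - 1)"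
      using c that by (auto simp: synor_chains_def)
    then have "boundary (link x c) = 0"
      using R[OF that] by (auto simp: represents_homology_def)
    then show ?thesis
      by (simp add: boundary_cone)
  qed
  then have "boundary (\<Sum>x\<in>J. cone x (link x c)) = (\<Sum>x\<in>J. link x c)"
    by (simp add: boundary_sum)
  then show ?thesis
    using sum_cone_link[of c r J i] c finJ True by (simp add: synor_chains_def)
next
  case False
  have "boundary c \<in> poset_chains r J (i - 1)"
    using c by (intro boundary_in_poset_chains) (auto simp: synor_chains_def)
  then show ?thesis
    using False by (simp add: poset_chains_less)
qed

text \<open>The boundary is a sum of representatives, and those at \<open>x\<close> lie in the
  subcomplex over \<open>below r P x\<close>, which is contained in the one over
  \<open>J\<close>.\<close>

lemma boundary_in_synor_chains:
  assumes J: "order_ideal r P J" and c: "c \<in> synor_chains r R J i"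
    and R: "\<And>x. x \<in> J \<Longrightarrow> represents_homology r (below r P x) R (R x)"
  shows "boundary c \<in> synor_chains r R J (i - 1)"
proof -
  have sub: "pm.subspace (R x i)" if "x \<in> J" for x i
    using R[OF that] by (simp add: represents_homology_def)
  have "link x c \<in> synor_chains r R J (i - 1)" if "x \<in> J" for x
  proof -
    have "link x c \<in> R x (i - 1)"
      using c that by (auto simp: synor_chains_def)
    then have "link x c \<in> synor_chains r R (below r P x) (i - 1)"
      using R[OF that] by (auto simp: represents_homology_def)
    then show ?thesis
      using synor_chains_mono[where R = R and i = "i - 1", OF below_subset_ideal[OF J that] sub] by blast
  qed
  moreover have "boundary c = (\<Sum>x\<in>{x\<in>J. i \<ge> 0}. link x c)"
    using J c R by (rule boundary_synor_chains_eq)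
  moreover have "pm.subspace (synor_chains r R J (i - 1))"
    by (intro subspace_synor_chains sub)
  ultimately show ?thesis
    by (auto intro!: pm.subspace_sum)
qed

lemma representatives_exist:
  "\<exists>R :: 'a \<Rightarrow> int \<Rightarrow> ('a list \<Rightarrow>\<^sub>0 'k::field) set.
     \<forall>x\<in>P. represents_homology r (below r P x) R (R x)"
proof -
  have wf: "wf {(y, x). x \<in> P \<and> y \<in> below r P x}"
  proof (rule wf_subset)
    have "finite r"
      using partial_order_onD(4)[OF po] finP by (auto intro: finite_subset)
    then show "wf (r - Id)"
      using po by (rule partial_order_on_well_order_on)
  qed (auto simp: below_def)
  have "\<exists>R :: 'a \<Rightarrow> int \<Rightarrow> ('a list \<Rightarrow>\<^sub>0 'k) set.
      \<forall>x. x \<in> P \<longrightarrow> represents_homology r (below r P x) R (R x)"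
  proof (rule dependent_wf_choice[OF wf])
    \<comment> \<open>The recursion is well defined: the condition on \<open>\<rho>\<close> consults
      \<open>R\<close> only at elements strictly below \<open>x\<close>.\<close>
    fix R R' :: "'a \<Rightarrow> int \<Rightarrow> ('a list \<Rightarrow>\<^sub>0 'k) set" and x \<rho>
    assume "\<And>z. (z, x) \<in> {(y, x). x \<in> P \<and> y \<in> below r P x} \<Longrightarrow> R z = R' z"
    then have "x \<in> P \<Longrightarrow> synor_chains r R (below r P x) i = synor_chains r R' (below r P x) i" for i
      by (intro synor_chains_cong) auto
    then show "(x \<in> P \<longrightarrow> represents_homology r (below r P x) R \<rho>) =
        (x \<in> P \<longrightarrow> represents_homology r (below r P x) R' \<rho>)"
      by (auto simp: represents_homology_def)
  next
    fix x and R :: "'a \<Rightarrow> int \<Rightarrow> ('a list \<Rightarrow>\<^sub>0 'k) set"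
    assume "\<And>y. (y, x) \<in> {(y, x). x \<in> P \<and> y \<in> below r P x} \<Longrightarrow>
      y \<in> P \<longrightarrow> represents_homology r (below r P y) R (R y)"
    then have R: "represents_homology r (below r P y) R (R y)" if "x \<in> P" "y \<in> below r P x" for y
      using that by (auto simp: below_def)
    let ?S = "synor_chains r R (below r P x)"
    have "\<exists>\<rho>. pm.subspace \<rho> \<and> \<rho> \<subseteq> {c \<in> ?S i. boundary c = 0} \<and>
        \<rho> \<inter> boundary ` ?S (i + 1) = {0} \<and>
        (\<forall>z\<in>{c \<in> ?S i. boundary c = 0}. \<exists>y\<in>\<rho>. z - y \<in> boundary ` ?S (i + 1))"
      if x: "x \<in> P" for i
    proof (rule pm.subspace_complement_exists)
      have S: "pm.subspace (?S i)" for i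
        using R[OF x] by (intro subspace_synor_chains) (auto simp: represents_homology_def)
      show "pm.subspace {c \<in> ?S i. boundary c = 0}" "pm.subspace (boundary ` ?S (i + 1))"
        by (intro subspace_cycles subspace_boundaries S)+
      \<comment> \<open>The choices strictly below \<open>x\<close> are already valid, so the
        boundary preserves the subcomplex over that ideal.\<close>
      have "boundary c \<in> ?S i" if "c \<in> ?S (i + 1)" for c
        using boundary_in_synor_chains[OF order_ideal_below that R[OF x]] by simp
      then show "boundary ` ?S (i + 1) \<subseteq> {c \<in> ?S i. boundary c = 0}"
        by auto
    qed
    \<comment> \<open>Complements exist degree by degree; \<open>choice\<close> turns them into one
      function of the degree.\<close>
    then have "\<exists>\<rho>. represents_homology r (below r P x) R \<rho>" if "x \<in> P"
      unfolding represents_homology_def using that by (intro choice) auto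
    then show "\<exists>\<rho>. x \<in> P \<longrightarrow> represents_homology r (below r P x) R \<rho>"
      by auto
  qed
  then show ?thesis by blast
qed

end

section \<open>Acyclicity of the chains modulo the subcomplex\<close>

locale poset_representatives = finite_poset P r
  for P :: "'a set" and r +
  fixes R :: "'a \<Rightarrow> int \<Rightarrow> ('a list \<Rightarrow>\<^sub>0 'k::field) set"
  assumes R: "x \<in> P \<Longrightarrow> represents_homology r (below r P x) R (R x)"
begin

lemma finite_ideal: "order_ideal r P J \<Longrightarrow> finite J"
  using finP by (auto simp: order_ideal_def intro: finite_subset)

lemma ideal_subset: "order_ideal r P J \<Longrightarrow> x \<in> J \<Longrightarrow> x \<in> P"
  by (auto simp: order_ideal_def)

lemma subspace_reps: "x \<in> P \<Longrightarrow> pm.subspace (R x i)"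
  using R by (simp add: represents_homology_def)

lemma reps_cycles:
  assumes "x \<in> P" "c \<in> R x i"
  shows "c \<in> synor_chains r R (below r P x) i" "boundary c = 0"
  using R[OF assms(1)] assms(2) by (auto simp: represents_homology_def)

lemma reps_boundary_eq_0:
  assumes "x \<in> P" "boundary c \<in> R x i" "c \<in> synor_chains r R (below r P x) (i + 1)"
  shows "boundary c = 0"
proof -
  have "boundary c \<in> R x i \<inter> boundary ` synor_chains r R (below r P x) (i + 1)"
    using assms(2,3) by blast
  then show ?thesis
    using R[OF assms(1)] by (auto simp: represents_homology_def)
qed

lemma reps_surj:
  assumes "x \<in> P" "c \<in> synor_chains r R (below r P x) i" "boundary c = 0"
  obtains y d where "y \<in> R x i" "d \<in> synor_chains r R (below r P x) (i + 1)" "c = y + boundary d"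
proof -
  have "\<exists>y\<in>R x i. c - y \<in> boundary ` synor_chains r R (below r P x) (i + 1)"
    using R[OF assms(1)] assms(2,3) by (auto simp: represents_homology_def)
  then show ?thesis
    using that by (auto simp: diff_eq_eq add.commute)
qed

lemma subspace_synor: "J \<subseteq> P \<Longrightarrow> pm.subspace (synor_chains r R J i)"
  by (intro subspace_synor_chains subspace_reps) auto

lemma synor_mono: "J \<subseteq> J' \<Longrightarrow> J' \<subseteq> P \<Longrightarrow> synor_chains r R J i \<subseteq> synor_chains r R J' i"
  by (intro synor_chains_mono subspace_reps) auto

lemma boundary_synor:
  "order_ideal r P J \<Longrightarrow> c \<in> synor_chains r R J i \<Longrightarrow> boundary c \<in> synor_chains r R J (i - 1)"
  by (intro boundary_in_synor_chains R) (auto simp: ideal_subset)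

text \<open>A link of such a chain has degree below -1, hence is zero and satisfies the
  condition.\<close>

lemma synor_chains_negative:
  assumes "J \<subseteq> P" "i < 0"
  shows "synor_chains r R J i = poset_chains r J i"
proof -
  have "link x c \<in> R x (i - 1)" if "c \<in> poset_chains r J i" "x \<in> J" for c x
    using link_in_poset_chains[OF that(1), of x] assms that(2) pm.subspace_0[OF subspace_reps, of x]
    by (auto simp: poset_chains_less)
  then show ?thesis
    by (auto simp: synor_chains_def)
qed

text \<open>The link of this cone at \<open>x\<close> is \<open>c\<close>, and its other links
  vanish.\<close>

lemma cone_in_synor:
  assumes J: "order_ideal r P J" "x \<in> J" and c: "c \<in> R x (i - 1)"
  shows "cone x c \<in> synor_chains r R J i"
proof -
  have "c \<in> poset_chains r (below r J x) (i - 1)"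
    using reps_cycles(1)[OF ideal_subset[OF J] c] below_ideal_eq[OF J]
    by (auto simp: synor_chains_def)
  then have "cone x c \<in> poset_chains r J i"
    using cone_in_poset_chains[of c r J x "i - 1"] J(2) by simp
  then show ?thesis
    using c pm.subspace_0[OF subspace_reps] J(1) by (auto simp: synor_chains_def ideal_subset)
qed

lemma boundary_cone_rep:
  "x \<in> P \<Longrightarrow> c \<in> R x i \<Longrightarrow> boundary (cone x c) = c"
  by (simp add: boundary_cone reps_cycles(2))

lemma maximal_element_exists:
  assumes "J \<subseteq> P" "J \<noteq> {}"
  obtains x where "x \<in> J" "\<And>y. y \<in> J \<Longrightarrow> (x, y) \<in> r \<Longrightarrow> y = x"
proof -
  have "finite (r\<inverse>)"
    using partial_order_onD(4)[OF po] finP by (auto intro: finite_subset)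
  then have "wf (r\<inverse> - Id)"
    using po by (intro partial_order_on_well_order_on) auto
  moreover obtain z where "z \<in> J"
    using assms by auto
  ultimately obtain x where "x \<in> J" "\<And>y. (y, x) \<in> r\<inverse> - Id \<Longrightarrow> y \<notin> J"
    by (rule wfE_min) auto
  then show ?thesis
    using that by auto
qed

text \<open>Acyclicity of the quotient gives both halves of the homology isomorphism at once. For a maximal
  element \<open>x\<close> of \<open>J\<close>, the coefficient \<open>link x c\<close> is shown to be a cycle of \<open>below r P x\<close>, and it is then
  replaced by its representative in \<open>R x\<close>.\<close>

lemma synor_chains_quotient_acyclic:
  assumes "order_ideal r P J" "c \<in> poset_chains r J i" "boundary c \<in> synor_chains r R J (i - 1)"
  shows "\<exists>s\<in>synor_chains r R J i. c - s \<in> boundary ` poset_chains r J (i + 1)"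
  using assms
proof (induction "card J" arbitrary: J c i rule: less_induct)
  case less
  note J = less.prems(1) and c = less.prems(2) and bc = less.prems(3)
  have JP: "J \<subseteq> P"
    using J by (simp add: order_ideal_def)
  show ?case
  proof (cases "J = {}")
    \<comment> \<open>Over the empty ideal the link conditions are vacuous, so \<open>c\<close>
      itself serves as \<open>s\<close>.\<close>
    case True
    then have "c \<in> synor_chains r R J i"
      using c by (simp add: synor_chains_def)
    then show ?thesis
      using pm.subspace_0[OF subspace_poset_chains] by (intro bexI[of _ c] image_eqI[of _ _ 0]) auto
  next
    case False
    then obtain x where x: "x \<in> J" and max: "\<And>y. y \<in> J \<Longrightarrow> (x, y) \<in> r \<Longrightarrow> y = x"
      using maximal_element_exists[OF JP] by blast
    define J' where "J' = J - {x}"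
    define B where "B = below r P x"
    have xP: "x \<in> P"
      using JP x by auto
    have J'J: "J' \<subseteq> J" "J' \<subseteq> P"
      using JP by (auto simp: J'_def)
    have J': "order_ideal r P J'"
      unfolding order_ideal_def
    proof (intro conjI ballI impI)
      fix z y assume z: "z \<in> J'" and y: "y \<in> P" "(y, z) \<in> r"
      then have "z \<in> J" "z \<noteq> x"
        by (simp_all add: J'_def)
      then show "y \<in> J'"
        using J y max[of z] unfolding J'_def order_ideal_def by blast
    qed (rule J'J(2))
    have xB: "x \<notin> B"
      by (simp add: B_def below_def)
    have B: "order_ideal r P B" "B \<subseteq> J'" "B \<subseteq> P"
      using order_ideal_below[of x] below_subset_ideal[OF J x] xB J'J
      by (auto simp: B_def J'_def)
    have "J' \<subset> J" "B \<subset> J"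
      using x B(2) by (auto simp: J'_def)
    then have card: "card J' < card J" "card B < card J"
      using psubset_card_mono[OF finite_ideal[OF J]] by simp_all
    have BJ: "below r J x = B"
      unfolding B_def using below_ideal_eq[OF J x] .
    \<comment> \<open>Since \<open>x\<close> is maximal, it can occur in a chain of \<open>J\<close>
      only as the head. Subtracting \<open>cone x a\<close> therefore leaves a chain
      \<open>c'\<close> over \<open>J'\<close>.\<close>
    define a where "a = link x c"
    define c' where "c' = c - cone x a"
    have a: "a \<in> poset_chains r B (i - 1)"
      using link_in_poset_chains[OF c, of x] by (simp add: a_def BJ)
    have "below r J y = below r J' y" if "y \<in> J'" for y
      using that max by (auto simp: below_def J'_def)
    then have chainsJ': "y # ys \<in> order_chains r J' j" if "y # ys \<in> order_chains r J j" "y \<noteq> x" for y ys j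
      using that by (auto simp: Cons_order_chains_iff J'_def)
    have c': "c' \<in> poset_chains r J' i"
      unfolding poset_chains_iff
    proof (intro allI impI)
      fix ys assume ys: "Poly_Mapping.lookup c' ys \<noteq> 0"
      show "ys \<in> order_chains r J' i"
      proof (cases ys)
        case Nil
        then have "[] \<in> order_chains r J i"
          using ys c by (simp add: c'_def lookup_minus poset_chains_iff)
        then show ?thesis
          using Nil by (simp add: order_chains_def)
      next
        case (Cons y zs)
        then have "y \<noteq> x" "Poly_Mapping.lookup c ys \<noteq> 0"
          using ys by (auto simp: c'_def a_def lookup_minus split: if_splits)
        then show ?thesis
          using Cons c chainsJ' by (auto simp: poset_chains_iff)
      qed
    qed
    have c_eq: "c = c' + cone x a"
      by (simp add: c'_def)
    have bc_eq: "boundary c = boundary c' + a - cone x (boundary a)"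
      by (simp add: c_eq boundary_add boundary_cone)
    \<comment> \<open>In \<open>bc_eq\<close> neither \<open>boundary c'\<close> nor
      \<open>a\<close> involves \<open>x\<close>. Comparing the links at \<open>x\<close> thus
      isolates \<open>boundary a\<close>, which the hypothesis on \<open>boundary c\<close> places
      in \<open>R x (i - 2)\<close>.\<close>
    have "link x (boundary c') = 0"
      using boundary_in_poset_chains[OF c'] by (rule link_eq_0) (simp add: J'_def)
    moreover have "link x a = 0"
      using a xB by (rule link_eq_0)
    ultimately have "link x (boundary c) = - boundary a"
      by (simp add: bc_eq link_add link_diff)
    moreover have "link x (boundary c) \<in> R x (i - 2)"
      using bc x by (auto simp: synor_chains_def)
    ultimately have ba: "boundary a \<in> R x (i - 2)"
      using pm.subspace_neg[OF subspace_reps[OF xP], of "- boundary a"] by simp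
    then have "boundary a \<in> synor_chains r R B (i - 1 - 1)"
      using reps_cycles(1)[OF xP ba] by (simp add: B_def)
    then obtain s d where s: "s \<in> synor_chains r R B (i - 1)" and d: "d \<in> poset_chains r B i"
      and as: "a - s = boundary d"
      using less.hyps[OF card(2) B(1) a] by auto
    \<comment> \<open>This element is a representative and also the boundary of the subcomplex chain
      \<open>s\<close>, so it is zero: \<open>s\<close> is a cycle and can be reduced to a
      representative \<open>\<rho>\<close>.\<close>
    have "boundary a = boundary s"
      using arg_cong[OF as, of boundary] by (simp add: boundary_diff)
    moreover from this have "boundary s = 0"
      using ba s reps_boundary_eq_0[OF xP, of s "i - 2"] by (simp add: B_def)
    ultimately obtain \<rho> t where \<rho>: "\<rho> \<in> R x (i - 1)" and t: "t \<in> synor_chains r R B i"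
      and st: "s = \<rho> + boundary t"
      using reps_surj[OF xP, of s "i - 1"] s by (auto simp: B_def)
    define e where "e = t + d"
    have e: "e \<in> poset_chains r B i"
      unfolding e_def using t d
      by (intro pm.subspace_add[OF subspace_poset_chains]) (auto simp: synor_chains_def)
    have "a = \<rho> + boundary e"
      using as st by (simp add: e_def boundary_add algebra_simps)
    \<comment> \<open>The cone over \<open>boundary e\<close> equals
      \<open>e - boundary (cone x e)\<close>. Replacing \<open>a\<close> by \<open>\<rho>\<close>
      therefore costs a boundary and the extra chain \<open>e\<close>, which already lies over
      \<open>J'\<close>.\<close>
    then have c_eq2: "c = c' + e + cone x \<rho> - boundary (cone x e)"
      by (simp add: c_eq cone_add boundary_cone)
    have c'e: "c' + e \<in> poset_chains r J' i"
      using c' e poset_chains_mono[OF B(2), of r i] by (intro pm.subspace_add[OF subspace_poset_chains]) auto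
    have b\<rho>: "boundary (cone x \<rho>) = \<rho>"
      using xP \<rho> by (rule boundary_cone_rep)
    then have "boundary (c' + e) = boundary c - \<rho>"
      by (subst c_eq2) (simp add: boundary_add boundary_diff)
    moreover have "\<rho> \<in> synor_chains r R J (i - 1)"
      using reps_cycles(1)[OF xP \<rho>] synor_mono[of B J "i - 1"] B(2) J'J(1) JP by (auto simp: B_def)
    ultimately have "boundary (c' + e) \<in> synor_chains r R J (i - 1)"
      using bc by (simp add: pm.subspace_diff[OF subspace_synor[OF JP]])
    \<comment> \<open>The link conditions for \<open>J'\<close> are among those for
      \<open>J\<close>, so the induction hypothesis applies to \<open>c' + e\<close> over
      \<open>J'\<close>.\<close>
    then have "boundary (c' + e) \<in> synor_chains r R J' (i - 1)"
      using boundary_in_poset_chains[OF c'e] J'J(1) by (auto simp: synor_chains_def)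
    then obtain s' d' where s': "s' \<in> synor_chains r R J' i" and d': "d' \<in> poset_chains r J' (i + 1)"
      and cs': "c' + e - s' = boundary d'"
      using less.hyps[OF card(1) J' c'e] by auto
    have "s' + cone x \<rho> \<in> synor_chains r R J i"
      using s' synor_mono[OF J'J(1) JP] cone_in_synor[OF J x \<rho>]
      by (intro pm.subspace_add[OF subspace_synor[OF JP]]) auto
    moreover have "c - (s' + cone x \<rho>) = boundary (d' - cone x e)"
      using cs' c_eq2 by (simp add: boundary_diff algebra_simps)
    moreover have "d' - cone x e \<in> poset_chains r J (i + 1)"
      using d' poset_chains_mono[OF J'J(1), of r "i + 1"] cone_in_poset_chains[of e r J x i] e x
      by (intro pm.subspace_diff[OF subspace_poset_chains]) (auto simp: BJ)
    ultimately show ?thesis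
      by blast
  qed
qed

text \<open>Injectivity on homology: modulo a boundary, the filling \<open>c\<close> may be replaced
  by a chain of the subcomplex with the same boundary.\<close>

lemma boundary_synor_of_boundary_poset:
  assumes "order_ideal r P J" "c \<in> poset_chains r J (i + 1)" "boundary c \<in> synor_chains r R J i"
  shows "boundary c \<in> boundary ` synor_chains r R J (i + 1)"
proof -
  obtain s d where "s \<in> synor_chains r R J (i + 1)" "c - s = boundary d"
    using synor_chains_quotient_acyclic[OF assms(1,2)] assms(3) by auto
  moreover from this(2) have "boundary (c - s) = 0"
    by simp
  then have "boundary c = boundary s"
    by (simp add: boundary_diff)
  ultimately show ?thesis
    by blast
qed

text \<open>Surjectivity on homology: acyclicity applies because the zero boundary lies in the
  subcomplex.\<close>

lemma cycle_homologous_to_synor: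
  assumes "order_ideal r P J" "c \<in> poset_chains r J i" "boundary c = 0"
  shows "\<exists>s\<in>synor_chains r R J i. boundary s = 0 \<and> c - s \<in> boundary ` poset_chains r J (i + 1)"
proof -
  have "0 \<in> synor_chains r R J (i - 1)"
    using assms(1) by (intro pm.subspace_0 subspace_synor) (simp add: order_ideal_def)
  then obtain s d where s: "s \<in> synor_chains r R J i" and d: "d \<in> poset_chains r J (i + 1)" "c - s = boundary d"
    using synor_chains_quotient_acyclic[OF assms(1,2)] assms(3) by auto
  have "boundary s = 0"
    using arg_cong[OF d(2), of boundary] assms(3) by (simp add: boundary_diff)
  then show ?thesis
    using s d by blast
qed

end

section \<open>The synor complex\<close>

lemma homology_eq_pm_quotient:
  assumes "\<And>i. component C i = pm_space (A i)" and "\<And>i. differential C i = boundary"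
  shows "homology C i = pm_quotient {c \<in> A i. boundary c = 0} (boundary ` A (i + 1))"
  by (simp add: homology_def pm_quotient_def cycles_def boundaries_def assms)

lemma component_order_complex: "component (order_complex r J) i = pm_space (poset_chains r J i)"
  by (simp add: order_complex_def free_space_eq_pm_space poset_chains_def)

lemma differential_order_complex: "differential (order_complex r J) i = boundary"
  by (simp add: order_complex_def)

lemma homology_order_complex:
  "homology (order_complex r J) i =
    pm_quotient {c \<in> poset_chains r J i. boundary c = 0} (boundary ` poset_chains r J (i + 1))"
  by (rule homology_eq_pm_quotient[OF component_order_complex differential_order_complex])

text \<open>Prepending \<open>x\<close> raises the degree by one, which accounts for the index
  \<open>i - 1\<close> of the representatives.\<close>

definition synor_graded ::
  "'a rel \<Rightarrow> 'a set \<Rightarrow> ('a \<Rightarrow> int \<Rightarrow> ('a list \<Rightarrow>\<^sub>0 'k) set) \<Rightarrow> ('k::field, 'a list \<Rightarrow>\<^sub>0 'k, 'a) graded_complex" where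
  "synor_graded r P R =
     \<lparr>component = (\<lambda>i. pm_space (synor_chains r R P i)),
      differential = (\<lambda>i. boundary),
      summand = (\<lambda>i x. cone x ` R x (i - 1))\<rparr>"

lemma synor_graded_simps [simp]:
  "component (synor_graded r P R) i = pm_space (synor_chains r R P i)"
  "differential (synor_graded r P R) i = boundary"
  "summand (synor_graded r P R) i x = cone x ` R x (i - 1)"
  by (simp_all add: synor_graded_def)

section \<open>Decomposition of the subcomplex into cones\<close>

context poset_representatives
begin

lemma order_ideal_P: "order_ideal r P P"
  by (simp add: order_ideal_def)

lemma subspace_summand: "x \<in> P \<Longrightarrow> pm.subspace (cone x ` R x i)"
  using subspace_reps[of x i] unfolding pm.subspace_def
  by (auto simp: cone_add[symmetric] cone_pscale[symmetric] intro: image_eqI[of _ _ 0])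

lemma sum_cones_in_synor:
  assumes "order_ideal r P J" "\<And>x. x \<in> J \<Longrightarrow> w x \<in> cone x ` R x (i - 1)"
  shows "(\<Sum>x\<in>J. w x) \<in> synor_chains r R J i"
proof (rule pm.subspace_sum)
  show "pm.subspace (synor_chains r R J i)"
    using assms(1) by (intro subspace_synor) (simp add: order_ideal_def)
  show "w x \<in> synor_chains r R J i" if "x \<in> J" for x
    using assms(2)[OF that] cone_in_synor[OF assms(1) that] by auto
qed

lemma finsum_synor:
  assumes "order_ideal r P J" "\<And>x. x \<in> J \<Longrightarrow> w x \<in> cone x ` R x (i - 1)"
  shows "finsum (pm_space (synor_chains r R P i)) w J = (\<Sum>x\<in>J. w x)"
proof (rule finsum_pm_space)
  show "w x \<in> synor_chains r R P i" if "x \<in> J" for x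
    using assms(2)[OF that] cone_in_synor[OF order_ideal_P ideal_subset[OF assms(1) that]] by auto
qed (use assms(1) in \<open>auto intro: subspace_synor finite_ideal\<close>)

lemma cone_link_in_summand:
  assumes "c \<in> synor_chains r R J i" "x \<in> J"
  shows "cone x (link x c) \<in> cone x ` R x (i - 1)"
  using assms by (auto simp: synor_chains_def)

lemma sum_cone_link_synor:
  assumes "order_ideal r P J" "c \<in> synor_chains r R J i" "i \<ge> 0"
  shows "(\<Sum>x\<in>J. cone x (link x c)) = c"
  using sum_cone_link[of c r J i] assms finite_ideal[OF assms(1)] by (simp add: synor_chains_def)

text \<open>A subcomplex chain is the sum of the cones over its links, and these links are
  representatives. This identifies the restriction to an ideal and also serves for the grading
  conditions.\<close>

lemma sum_of_summands:
  assumes J: "order_ideal r P J" and i: "i \<ge> 0"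
  shows "sum_of_subspaces (pm_space (synor_chains r R P i)) (\<lambda>x. cone x ` R x (i - 1)) J =
    synor_chains r R J i"
proof (intro equalityI subsetI)
  fix c assume "c \<in> sum_of_subspaces (pm_space (synor_chains r R P i)) (\<lambda>x. cone x ` R x (i - 1)) J"
  then obtain w where w: "\<And>x. x \<in> J \<Longrightarrow> w x \<in> cone x ` R x (i - 1)"
    and c: "c = finsum (pm_space (synor_chains r R P i)) w J"
    unfolding sum_of_subspaces_def by blast
  have "c = (\<Sum>x\<in>J. w x)"
    unfolding c using J w by (rule finsum_synor)
  moreover have "(\<Sum>x\<in>J. w x) \<in> synor_chains r R J i"
    using J w by (rule sum_cones_in_synor)
  ultimately show "c \<in> synor_chains r R J i"
    by simp
next
  fix c assume c: "c \<in> synor_chains r R J i"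
  let ?w = "\<lambda>x. cone x (link x c)"
  have w: "?w x \<in> cone x ` R x (i - 1)" if "x \<in> J" for x
    using c that by (rule cone_link_in_summand)
  then have "finsum (pm_space (synor_chains r R P i)) ?w J = c"
    using finsum_synor[OF J, of ?w i] sum_cone_link_synor[OF J c i] by simp
  moreover have "finsum (pm_space (synor_chains r R P i)) ?w J
      \<in> sum_of_subspaces (pm_space (synor_chains r R P i)) (\<lambda>x. cone x ` R x (i - 1)) J"
    unfolding sum_of_subspaces_def using w by (intro imageI) auto
  ultimately show "c \<in> sum_of_subspaces (pm_space (synor_chains r R P i)) (\<lambda>x. cone x ` R x (i - 1)) J"
    by simp
qed

text \<open>Summation has an explicit inverse, sending \<open>c\<close> to the family of its parts
  \<open>cone x (link x c)\<close>.\<close>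

lemma internal_direct_sum_synor:
  assumes i: "i \<ge> 0"
  shows "internal_direct_sum (pm_space (synor_chains r R P i)) (\<lambda>x. cone x ` R x (i - 1)) P"
  unfolding internal_direct_sum_def
proof (intro conjI ballI)
  fix x assume "x \<in> P"
  then show "subspace class_ring (cone x ` R x (i - 1)) (pm_space (synor_chains r R P i))"
    using cone_in_synor[OF order_ideal_P, of x _ i]
    by (intro subspace_pm_space subspace_synor subspace_summand) blast+
next
  let ?sum = "\<lambda>w. finsum (pm_space (synor_chains r R P i)) w P"
  let ?parts = "\<lambda>c. \<lambda>x\<in>P. cone x (link x c)"
  let ?W = "\<Pi>\<^sub>E x\<in>P. cone x ` R x (i - 1)"
  have sum: "?sum w = (\<Sum>x\<in>P. w x)" if "w \<in> ?W" for w
    using PiE_mem[OF that] by (intro finsum_synor[OF order_ideal_P])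
  have parts: "?parts c \<in> ?W" if "c \<in> synor_chains r R P i" for c
    unfolding restrict_PiE_iff by (intro ballI cone_link_in_summand[OF that])
  show "bij_betw ?sum ?W (carrier (pm_space (synor_chains r R P i)))"
  proof (rule bij_betw_byWitness[where f' = ?parts])
    show "\<forall>w\<in>?W. ?parts (?sum w) = w"
    proof
      fix w assume w: "w \<in> ?W"
      \<comment> \<open>The entry at \<open>y\<close> is a cone with apex \<open>y\<close>, so its
        link at any other element vanishes; \<open>link x\<close> picks one entry out of the
        sum.\<close>
      have link_w: "link x (w y) = (if y = x then link x (w x) else 0)" if y: "y \<in> P" for x y
      proof -
        obtain \<rho> where "w y = cone y \<rho>"
          using PiE_mem[OF w y] by (rule imageE)
        then show ?thesis
          by (cases "y = x") simp_all
      qed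
      have link_sum: "link x (\<Sum>y\<in>Q. w y) = (\<Sum>y\<in>Q. link x (w y))" if "finite Q" for x Q
        using that by (induction Q) (simp_all add: link_add)
      have "link x (?sum w) = link x (w x)" if "x \<in> P" for x
      proof -
        have "link x (?sum w) = (\<Sum>y\<in>P. link x (w y))"
          unfolding sum[OF w] by (rule link_sum[OF finP])
        also have "\<dots> = (\<Sum>y\<in>P. if y = x then link x (w x) else 0)"
          by (rule sum.cong[OF refl link_w])
        finally show ?thesis
          using that finP by simp
      qed
      moreover have "cone x (link x (w x)) = w x" if x: "x \<in> P" for x
      proof -
        obtain \<rho> where "w x = cone x \<rho>"
          using PiE_mem[OF w x] by (rule imageE)
        then show ?thesis
          by simp
      qed
      ultimately show "?parts (?sum w) = w"
        using PiE_arb[OF w] by (intro ext) (simp add: restrict_def)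
    qed
    show "\<forall>c\<in>carrier (pm_space (synor_chains r R P i)). ?sum (?parts c) = c"
    proof
      fix c assume "c \<in> carrier (pm_space (synor_chains r R P i))"
      then have c: "c \<in> synor_chains r R P i"
        by simp
      show "?sum (?parts c) = c"
        unfolding sum[OF parts[OF c]] using sum_cone_link_synor[OF order_ideal_P c i]
        by simp
    qed
    show "?sum ` ?W \<subseteq> carrier (pm_space (synor_chains r R P i))"
    proof (intro image_subsetI)
      fix w assume w: "w \<in> ?W"
      then have "(\<Sum>x\<in>P. w x) \<in> synor_chains r R P i"
        by (intro sum_cones_in_synor[OF order_ideal_P] PiE_mem[OF w])
      then show "?sum w \<in> carrier (pm_space (synor_chains r R P i))"
        by (simp add: sum[OF w])
    qed
    show "?parts ` carrier (pm_space (synor_chains r R P i)) \<subseteq> ?W"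
      by (intro image_subsetI parts) simp
  qed
qed

section \<open>Verification of the synor conditions\<close>

lemma is_strictly_graded_synor: "is_strictly_graded r P (synor_graded r P R)"
proof -
  let ?S = "synor_graded r P R"
  have S_neg: "synor_chains r R P i = poset_chains r P i" if "i < 0" for i
    using that by (intro synor_chains_negative) auto
  have "is_complex ?S"
    unfolding is_complex_def
  proof (intro conjI allI impI)
    fix i :: int
    show "linear_map class_ring (component ?S i) (component ?S (i - 1)) (differential ?S i)"
      by (rule linear_mapI) (use boundary_synor[OF order_ideal_P] in
        \<open>auto simp: vectorspace_pm_space subspace_synor boundary_add boundary_pscale\<close>)
    show "carrier (component ?S i) = {\<zero>\<^bsub>component ?S i\<^esub>}" if "i < -1"
      using that by (simp add: S_neg poset_chains_less)
  qed simp
  moreover have "\<exists>e\<in>carrier (component ?S (-1)).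
      bij_betw (\<lambda>a. a \<odot>\<^bsub>component ?S (-1)\<^esub> e) UNIV (carrier (component ?S (-1)))"
    \<comment> \<open>The generator in degree -1 is the empty chain with coefficient 1.\<close>
    by (rule bexI[of _ "Poly_Mapping.single [] 1"])
      (auto simp: S_neg poset_chains_minus_one bij_betw_def inj_on_def intro: inj_onD[OF inj_single])
  moreover have "\<forall>i\<ge>0. internal_direct_sum (component ?S i) (summand ?S i) P"
    using internal_direct_sum_synor by (simp add: synor_graded_def)
  \<comment> \<open>The boundary of a cone over a representative is that representative, which lives
    over \<open>below r P x\<close>. Taking for \<open>J\<close> the elements at most
    \<open>x\<close> gives the grading, and taking \<open>below r P x\<close> gives
    strictness.\<close>
  moreover have differential: "differential ?S i ` summand ?S i x \<subseteq>
      sum_of_subspaces (component ?S (i - 1)) (summand ?S (i - 1)) J"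
    if i: "i \<ge> 1" and x: "x \<in> P" and J: "order_ideal r P J" "below r P x \<subseteq> J" for i x J
  proof -
    have "R x (i - 1) \<subseteq> synor_chains r R J (i - 1)"
      using reps_cycles(1)[OF x] synor_mono[OF J(2)] J(1) by (auto simp: order_ideal_def)
    then have "boundary ` cone x ` R x (i - 1) \<subseteq> synor_chains r R J (i - 1)"
      using boundary_cone_rep[OF x] by auto
    then show ?thesis
      using sum_of_summands[OF J(1), of "i - 1"] i by (simp add: synor_graded_def)
  qed
  moreover have "order_ideal r P {y\<in>P. (y, x) \<in> r}" for x
    using po by (auto simp: order_ideal_def dest: partial_order_onD(2) transD)
  then have "differential ?S i ` summand ?S i x \<subseteq>
      sum_of_subspaces (component ?S (i - 1)) (summand ?S (i - 1)) {y\<in>P. (y, x) \<in> r}"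
    if "i \<ge> 1" "x \<in> P" for i x
    using that by (intro differential) (auto simp: below_def)
  moreover have "differential ?S i ` summand ?S i x \<subseteq>
      sum_of_subspaces (component ?S (i - 1)) (summand ?S (i - 1)) (below r P x)"
    if "i \<ge> 1" "x \<in> P" for i x
    using that order_ideal_below by (intro differential) auto
  ultimately show ?thesis
    unfolding is_strictly_graded_def is_graded_def by blast
qed

lemma graded_chain_map_synor:
  "graded_chain_map P (synor_graded r P R) (order_complex r P) (\<lambda>i c. c)"
  unfolding graded_chain_map_def
proof (intro conjI allI impI ballI)
  fix i :: int
  show "linear_map class_ring (component (synor_graded r P R) i) (component (order_complex r P) i) (\<lambda>c. c)"
    by (rule linear_mapI) (auto simp: component_order_complex vectorspace_pm_space subspace_synor
        subspace_poset_chains subsetD[OF synor_chains_subset])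
  show "(\<lambda>c. c) ` summand (synor_graded r P R) i x \<subseteq> summand (order_complex r P) i x" if "x \<in> P" for x
  proof (clarsimp simp: order_complex_def)
    fix c xs assume "c \<in> R x (i - 1)" and xs: "xs \<in> Poly_Mapping.keys (cone x c)"
    then have "cone x c \<in> poset_chains r P i"
      using cone_in_synor[OF order_ideal_P that] by (auto simp: synor_chains_def)
    then show "xs \<in> order_chains r P i \<and> xs \<noteq> [] \<and> hd xs = x"
      using xs by (cases xs) (auto simp: poset_chains_def in_keys_iff split: if_splits)
  qed
qed (simp_all add: component_order_complex differential_order_complex synor_chains_negative)

text \<open>Sending the cone over a representative to the homology class of the representative is a
  linear bijection. The summand meant is the one in degree \<open>i + 1\<close>.\<close>

lemma dim_summand:
  assumes x: "x \<in> P"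
  shows "vectorspace.dim class_ring (pm_space (cone x ` R x i)) =
    vectorspace.dim class_ring (homology (order_complex r (below r P x)) i :: ('k, _) module)"
proof -
  define B where "B = below r P x"
  have B: "order_ideal r P B"
    unfolding B_def by (rule order_ideal_below)
  let ?Z = "{c \<in> poset_chains r B i. boundary c = (0 :: 'a list \<Rightarrow>\<^sub>0 'k)}"
  let ?D = "boundary ` poset_chains r B (i + 1) :: ('a list \<Rightarrow>\<^sub>0 'k) set"
  let ?f = "\<lambda>c. pm_coset ?D (link x c)"
  have rep: "c \<in> ?Z" if "c \<in> R x i" for c
    using reps_cycles[OF x that] by (auto simp: B_def synor_chains_def)
  have D: "pm.subspace ?D"
    by (intro subspace_boundaries subspace_poset_chains)
  have "linear_map class_ring (pm_space (cone x ` R x i)) (pm_quotient ?Z ?D) ?f"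
    using D rep x
    by (intro linear_map_pm_quotient subspace_summand subspace_cycles subspace_poset_chains)
      (auto simp: link_add link_pscale)
  moreover have "bij_betw ?f (carrier (pm_space (cone x ` R x i))) (carrier (pm_quotient ?Z ?D))"
    unfolding bij_betw_def
  proof
    show "inj_on ?f (carrier (pm_space (cone x ` R x i)))"
    proof (rule inj_onI, clarsimp)
      fix c d assume cd: "c \<in> R x i" "d \<in> R x i" and "pm_coset ?D c = pm_coset ?D d"
      then obtain e where e: "e \<in> poset_chains r B (i + 1)" "c - d = boundary e"
        using D by (auto simp: pm_coset_eq_iff)
      have cdR: "c - d \<in> R x i"
        using cd subspace_reps[OF x] by (intro pm.subspace_diff)
      \<comment> \<open>A difference of representatives that bounds in the full chain complex also
        bounds in the subcomplex, so the complement property makes it zero.\<close>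
      then have "boundary e \<in> synor_chains r R B i"
        using reps_cycles(1)[OF x] e(2) by (simp add: B_def)
      then obtain s where s: "s \<in> synor_chains r R B (i + 1)" "boundary e = boundary s"
        using boundary_synor_of_boundary_poset[OF B e(1)] by auto
      then have "boundary s = 0"
        using reps_boundary_eq_0[OF x, of s i] cdR e(2) by (simp add: B_def)
      then have "c = d"
        using e(2) s(2) by simp
      then show "cone x c = cone x d"
        by simp
    qed
    \<comment> \<open>A cycle is replaced first by a homologous cycle of the subcomplex, then by its
      representative.\<close>
    have "\<exists>y\<in>R x i. c - y \<in> ?D" if c: "c \<in> ?Z" for c
    proof -
      obtain s d where s: "s \<in> synor_chains r R B i" "boundary s = 0"
        and d: "d \<in> poset_chains r B (i + 1)" "c - s = boundary d"
        using cycle_homologous_to_synor[OF B, of c i] c by blast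
      obtain y e where y: "y \<in> R x i" and e: "e \<in> synor_chains r R B (i + 1)" "s = y + boundary e"
        using reps_surj[OF x, of s i] s unfolding B_def by blast
      have "c - y = boundary (d + e)"
        using d(2) e(2) by (simp add: boundary_add algebra_simps)
      moreover have "d + e \<in> poset_chains r B (i + 1)"
        using d(1) e(1) by (intro pm.subspace_add[OF subspace_poset_chains]) (auto simp: synor_chains_def)
      ultimately show ?thesis
        using y by blast
    qed
    then have surj: "\<exists>y\<in>R x i. pm_coset ?D c = pm_coset ?D y" if "c \<in> ?Z" for c
      using that D by (simp add: pm_coset_eq_iff)
    show "?f ` carrier (pm_space (cone x ` R x i)) = carrier (pm_quotient ?Z ?D)"
    proof (intro equalityI subsetI)
      fix X assume "X \<in> carrier (pm_quotient ?Z ?D)"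
      then obtain c where "c \<in> ?Z" "X = pm_coset ?D c"
        unfolding carrier_pm_quotient by blast
      with surj obtain y where y: "y \<in> R x i" and X: "X = ?f (cone x y)"
        by auto
      show "X \<in> ?f ` carrier (pm_space (cone x ` R x i))"
        unfolding X using y by (intro imageI) simp
    next
      fix X assume "X \<in> ?f ` carrier (pm_space (cone x ` R x i))"
      then obtain c where "c \<in> R x i" "X = pm_coset ?D c"
        by auto
      then show "X \<in> carrier (pm_quotient ?Z ?D)"
        unfolding carrier_pm_quotient using rep by blast
    qed
  qed
  ultimately have "vectorspace.dim class_ring (pm_space (cone x ` R x i)) =
      vectorspace.dim class_ring (pm_quotient ?Z ?D)"
    by (rule linear_map.dim_eq_of_bij)
  then show ?thesis
    by (simp add: homology_order_complex B_def)
qed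

text \<open>The two consequences of acyclicity are precisely the injectivity and surjectivity
  hypotheses of \<open>quotient_map_inclusion\<close>.\<close>

lemma induces_homology_iso_synor:
  assumes J: "order_ideal r P J"
  shows "induces_homology_iso (restrict_complex J (synor_graded r P R)) (order_complex r J) (\<lambda>i c. c)"
proof -
  have JP: "J \<subseteq> P"
    using J by (simp add: order_ideal_def)
  let ?C = "restrict_complex J (synor_graded r P R)"
  have comp: "component ?C i = pm_space (synor_chains r R J i)" for i
  proof (cases "i \<ge> 0")
    case True
    then show ?thesis
      using sum_of_summands[OF J True] by (simp add: restrict_complex_def synor_graded_def)
  next
    \<comment> \<open>In negative degrees \<open>restrict_complex\<close> keeps the component over
      \<open>P\<close>; there the chain spaces of \<open>P\<close> and \<open>J\<close>
      coincide.\<close>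
    case False
    moreover from this have "(poset_chains r P i :: ('a list \<Rightarrow>\<^sub>0 'k) set) = poset_chains r J i"
      by (cases "i = -1") (simp_all add: poset_chains_minus_one poset_chains_less)
    ultimately show ?thesis
      by (simp add: restrict_complex_def synor_chains_negative JP)
  qed
  have diff: "differential ?C i = boundary" for i
    by (simp add: restrict_complex_def)
  have induced: "induced_map (order_complex r J) (\<lambda>i c. c) i =
      (\<lambda>X. \<Union>c\<in>X. pm_coset (boundary ` poset_chains r J (i + 1)) (c :: 'a list \<Rightarrow>\<^sub>0 'k))" for i
    by (simp add: induced_map_def fun_eq_iff boundaries_def component_order_complex differential_order_complex)
  let ?Z = "\<lambda>i. {c \<in> synor_chains r R J i. boundary c = 0}"
  let ?D = "\<lambda>i. boundary ` synor_chains r R J (i + 1)"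
  let ?Z' = "\<lambda>i. {c \<in> poset_chains r J i. boundary c = (0 :: 'a list \<Rightarrow>\<^sub>0 'k)}"
  let ?D' = "\<lambda>i. boundary ` poset_chains r J (i + 1) :: ('a list \<Rightarrow>\<^sub>0 'k) set"
  have "pm.subspace (?Z i)" "pm.subspace (?D i)" "pm.subspace (?Z' i)" "pm.subspace (?D' i)"
    "?Z i \<subseteq> ?Z' i" "?D i \<subseteq> ?D' i" for i
    using subsetD[OF synor_chains_subset, of _ r R J] by (auto intro!: subspace_cycles subspace_boundaries subspace_synor[OF JP] subspace_poset_chains)
  moreover have "?Z i \<inter> ?D' i \<subseteq> ?D i" for i
    using boundary_synor_of_boundary_poset[OF J] by auto
  moreover have "\<exists>a\<in>?Z i. c - a \<in> ?D' i" if "c \<in> ?Z' i" for c i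
    using cycle_homologous_to_synor[OF J, of c i] that by blast
  ultimately have "linear_map class_ring (pm_quotient (?Z i) (?D i)) (pm_quotient (?Z' i) (?D' i))
        (\<lambda>X. \<Union>c\<in>X. pm_coset (?D' i) c)"
      "bij_betw (\<lambda>X. \<Union>c\<in>X. pm_coset (?D' i) c) (carrier (pm_quotient (?Z i) (?D i)))
        (carrier (pm_quotient (?Z' i) (?D' i)))" for i
    by (intro quotient_map_inclusion; blast)+
  then show ?thesis
    unfolding induces_homology_iso_def induced
      homology_eq_pm_quotient[where C = ?C, OF comp diff] homology_order_complex
    by blast
qed

lemma synor_complex_synor_graded: "synor_complex r P (synor_graded r P R) (\<lambda>i c. c)"
  unfolding synor_complex_def
  using is_strictly_graded_synor graded_chain_map_synor dim_summand induces_homology_iso_synor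
  by (auto simp: inj_on_def)

end

theorem proposition3p2:
  fixes P :: "'a set" and r :: "'a rel"
  assumes "finite P" and "partial_order_on P r"
  shows "\<exists>(S :: ('k::field, 'a list \<Rightarrow>\<^sub>0 'k, 'a) graded_complex) \<phi>. synor_complex r P S \<phi>"
proof -
  interpret finite_poset P r
    using assms by unfold_locales
  obtain R :: "'a \<Rightarrow> int \<Rightarrow> ('a list \<Rightarrow>\<^sub>0 'k) set"
    where "\<forall>x\<in>P. represents_homology r (below r P x) R (R x)"
    using representatives_exist by blast
  then interpret poset_representatives P r R
    by unfold_locales blast
  show ?thesis
    using synor_complex_synor_graded by blast
qed

end
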